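(* Assume (C1)–(C4) hold and that $L$ and $g$ do not depend on $t$, i.e. $L(t,x,u)=L(x,u)$ and $g(t,x)=g(x)$. Let $(\hat u(\cdot),\hat x(\cdot))$ be a solution of problem (P). Then for almost every $t\in[0,1]$, $$ |\hat u(t)|\le \ell:=\max\left\{\sqrt{\frac{2}{\mu}\left(\Lambda_0+\beta\right)},\;\frac{\Lambda_1+\sqrt{\Lambda_1^2+4\mu\Lambda_0}}{2}\right\}. $$
   Context: Let $n,m\ge1$; $|\cdot|$ denotes the Euclidean norm (operator norm for matrices) and $B_n$ the closed unit ball of $\mathbb R^n$. Let $L:[0,1]\times\mathbb R^n\times\mathbb R^m\to\mathbb R$ and $g:[0,1]\times\mathbb R^n\to\mathbb R^{n\times m}$ be continuously differentiable. Problem (P) (Lagrange problem): minimize $J(u,x)=\int_0^1 L(t,x(t),u(t))\,dt$ over admissible processes, i.e. pairs $(u,x)\in L_1([0,1],\mathbb R^m)\times AC([0,1],\mathbb R^n)$ with $\dot x(t)=g(t,x(t))u(t)$ for a.e. $t$ and $x(0)=0$; a solution is an admissible process minimizing $J$. Standing conditions: (C1) there is a function $\theta:[0,\infty)\to\mathbb R$ with $L(t,x,u)\ge\theta(|u|)>0$ for all $t,x,u$ and $\lim_{r\to\infty}r/\theta(r)=0$; (C2) there is $\mu>0$ with $L(t,x,u)+\langle\nabla_uL(t,x,u),v-u\rangle+\frac{\mu}{2}|v-u|^2\le L(t,x,v)$ for all $t,x,u,v$; (C3) there are constants $\xi>0,\delta>0$ with $|\nabla_{(t,x)}L(t,x,u)|\,|g(t,x)u|\le\xi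 L(t,x,u)+\delta$ for all $t,x,u$; (C4) there are constants $c_g>0$, $c_{\nabla g}>0$ with $|g(t,x)|\le c_g$ and $|\nabla_{(t,x)}g(t,x)|\le c_{\nabla g}$ for all $t,x$. Constants: fix $r_0>0$ such that $\theta(r)\ge r$ for all $r\ge r_0$; $c=r_0+\int_0^1L(t,0,0)\,dt$; $\Omega=[0,1]\times c_g c\,B_n$; $\Lambda_0=\max_{(t,x)\in\Omega}L(t,x,0)$; $\Lambda_1=\max_{(t,x)\in\Omega}|\nabla_uL(t,x,0)|$; $\sigma(r)=\max_{(t,x)\in\Omega,\,|u|\le r}\big(\langle\nabla_uL(t,x,u),u\rangle-L(t,x,u)\big)$; fix $T_0\in(0,1)$ such that $\beta:=\sigma((c+1)/T_0)>\delta/\xi$. *)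

theory Defs
  imports "HOL-Analysis.Analysis"
begin

definition abs_cont_on :: "real \<Rightarrow> real \<Rightarrow> (real \<Rightarrow> 'a::real_normed_vector) \<Rightarrow> bool" where
  "abs_cont_on a b f \<longleftrightarrow>
     (\<forall>\<epsilon>>0. \<exists>\<delta>>0. \<forall>D::(real \<times> real) set.
        finite D \<longrightarrow>
        (\<forall>(s,t)\<in>D. a \<le> s \<and> s \<le> t \<and> t \<le> b) \<longrightarrow>
        (\<forall>I\<in>D. \<forall>J\<in>D. I \<noteq> J \<longrightarrow> {fst I<..<snd I} \<inter> {fst J<..<snd J} = {}) \<longrightarrow>
        (\<Sum>(s,t)\<in>D. t - s) < \<delta> \<longrightarrow>
        (\<Sum>(s,t)\<in>D. norm (f t - f s)) < \<epsilon>)"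

definition admissible ::
  "(real^'n \<Rightarrow> real^'m^'n) \<Rightarrow> (real \<Rightarrow> real^'m) \<Rightarrow> (real \<Rightarrow> real^'n) \<Rightarrow> bool" where
  "admissible g u x \<longleftrightarrow>
     integrable (lebesgue_on {0..1}) u \<and>
     abs_cont_on 0 1 x \<and>
     (AE t in lebesgue. t \<in> {0..1} \<longrightarrow>
        (x has_vector_derivative (g (x t) *v u t)) (at t within {0..1})) \<and>
     x 0 = 0"

text \<open>Cost functional J(u,x) = integral over [0,1] of L(x(t),u(t)); since L > 0 it is
  taken as a nonnegative extended-real (possibly infinite) integral.\<close>
definition cost ::
  "(real^'n \<Rightarrow> real^'m \<Rightarrow> real) \<Rightarrow> (real \<Rightarrow> real^'m) \<Rightarrow> (real \<Rightarrow> real^'n) \<Rightarrow> ennreal" where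
  "cost L u x = (\<integral>\<^sup>+ t. ennreal (L (x t) (u t)) \<partial>(lebesgue_on {0..1}))"

definition is_solution ::
  "(real^'n \<Rightarrow> real^'m \<Rightarrow> real) \<Rightarrow> (real^'n \<Rightarrow> real^'m^'n) \<Rightarrow>
   (real \<Rightarrow> real^'m) \<Rightarrow> (real \<Rightarrow> real^'n) \<Rightarrow> bool" where
  "is_solution L g u x \<longleftrightarrow> admissible g u x \<and>
     (\<forall>v y. admissible g v y \<longrightarrow> cost L u x \<le> cost L v y)"

end

theory Submission
  imports Defs
begin

text \<open>
  Since the dynamics are linear in the control, reparametrising time turns an admissible process
  \<open>(u, x)\<close> into another one: with time density \<open>w > 0\<close>, \<open>\<integral> w = 1\<close>, the new control is \<open>u / w\<close> and the new
  cost is \<open>\<integral> w L(x, u / w)\<close>. The first variation of this cost at \<open>w = 1\<close> is minus the energy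
  \<open>E = \<langle>\<nabla>\<^sub>u L, u\<rangle> - L\<close>, so along a solution \<open>E\<close> cannot be essentially larger on one set of times than
  on another. Comparing with the zero control gives \<open>\<integral> |u| \<le> c\<close>; hence \<open>x\<close> stays in \<open>\<Omega>\<close>, and
  \<open>|u| \<le> (c + 1) / T\<^sub>0\<close>, thus \<open>E \<le> \<beta>\<close>, on a set of positive measure. Therefore \<open>E \<le> \<beta>\<close> almost
  everywhere, and strong convexity (C2) between \<open>u\<close> and \<open>0\<close> gives \<open>\<mu>/2 |u|\<^sup>2 \<le> \<Lambda>\<^sub>0 + \<beta>\<close>.
\<close>

section \<open>Absolutely continuous functions\<close>

lemma abs_cont_onD:
  assumes "abs_cont_on a b f" "\<epsilon> > 0"
  obtains \<delta> where "\<delta> > 0"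
    "\<And>D. \<lbrakk>finite D; \<And>s t. (s,t) \<in> D \<Longrightarrow> a \<le> s \<and> s \<le> t \<and> t \<le> b;
           \<And>I J. \<lbrakk>I \<in> D; J \<in> D; I \<noteq> J\<rbrakk> \<Longrightarrow> {fst I<..<snd I} \<inter> {fst J<..<snd J} = {};
           (\<Sum>(s,t)\<in>D. t - s) < \<delta>\<rbrakk> \<Longrightarrow> (\<Sum>(s,t)\<in>D. norm (f t - f s)) < \<epsilon>"
proof -
  from assms obtain \<delta> where "\<delta> > 0" and
    *: "\<forall>D. finite D \<longrightarrow>
        (\<forall>(s,t)\<in>D. a \<le> s \<and> s \<le> t \<and> t \<le> b) \<longrightarrow>
        (\<forall>I\<in>D. \<forall>J\<in>D. I \<noteq> J \<longrightarrow> {fst I<..<snd I} \<inter> {fst J<..<snd J} = {}) \<longrightarrow>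
        (\<Sum>(s,t)\<in>D. t - s) < \<delta> \<longrightarrow> (\<Sum>(s,t)\<in>D. norm (f t - f s)) < \<epsilon>"
    unfolding abs_cont_on_def by blast
  show ?thesis
    by (rule that[OF \<open>\<delta> > 0\<close>], rule *[rule_format]) auto
qed

lemma abs_cont_on_imp_continuous_on:
  assumes "abs_cont_on a b f"
  shows "continuous_on {a..b} f"
proof (clarsimp simp: continuous_on_iff)
  fix x e :: real
  assume x: "a \<le> x" "x \<le> b" and "e > 0"
  obtain \<delta> where d: "\<delta> > 0" and
    *: "\<And>D. \<lbrakk>finite D; \<And>s t. (s,t) \<in> D \<Longrightarrow> a \<le> s \<and> s \<le> t \<and> t \<le> b;
           \<And>I J. \<lbrakk>I \<in> D; J \<in> D; I \<noteq> J\<rbrakk> \<Longrightarrow> {fst I<..<snd I} \<inter> {fst J<..<snd J} = {};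
           (\<Sum>(s,t)\<in>D. t - s) < \<delta>\<rbrakk> \<Longrightarrow> (\<Sum>(s,t)\<in>D. norm (f t - f s)) < e"
    using abs_cont_onD[OF assms \<open>e > 0\<close>] by blast
  have **: "norm (f t - f s) < e" if "a \<le> s" "s \<le> t" "t \<le> b" "t - s < \<delta>" for s t
    using *[of "{(s,t)}"] that by auto
  show "\<exists>d>0. \<forall>x'\<in>{a..b}. dist x' x < d \<longrightarrow> dist (f x') (f x) < e"
  proof (intro exI[of _ \<delta>] conjI ballI impI d)
    fix x' assume x': "x' \<in> {a..b}" "dist x' x < \<delta>"
    show "dist (f x') (f x) < e"
    proof (cases "x \<le> x'")
      case True
      then show ?thesis
        using **[of x x'] x x' by (auto simp: dist_norm)
    next
      case False
      then show ?thesis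
        using **[of x' x] x x' by (auto simp: dist_norm norm_minus_commute)
    qed
  qed
qed

text \<open>Clamping the argument to \<open>{a..b}\<close> extends \<open>x\<close> continuously to
  the whole line, whatever \<open>x\<close> is outside the interval. The trajectory thereby gets a
  Borel version for integrals against \<open>lborel\<close>.\<close>

lemma borel_measurable_abs_cont_on_clamp:
  fixes x :: "real \<Rightarrow> 'a::real_normed_vector"
  assumes "abs_cont_on a b x" "a \<le> b"
  shows "(\<lambda>t. x (max a (min b t))) \<in> borel_measurable borel"
proof (rule borel_measurable_continuous_onI)
  show "continuous_on UNIV (\<lambda>t. x (max a (min b t)))"
    by (rule continuous_on_compose2[OF abs_cont_on_imp_continuous_on[OF assms(1)]])
      (use assms(2) in \<open>auto intro!: continuous_intros\<close>)
qed

lemma abs_cont_on_subset: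
  assumes "abs_cont_on a b f" "a \<le> c" "d \<le> b"
  shows "abs_cont_on c d f"
  unfolding abs_cont_on_def
proof (intro allI impI)
  fix \<epsilon> :: real assume "\<epsilon> > 0"
  obtain \<delta> where d: "\<delta> > 0" and
    *: "\<And>D. \<lbrakk>finite D; \<And>s t. (s,t) \<in> D \<Longrightarrow> a \<le> s \<and> s \<le> t \<and> t \<le> b;
           \<And>I J. \<lbrakk>I \<in> D; J \<in> D; I \<noteq> J\<rbrakk> \<Longrightarrow> {fst I<..<snd I} \<inter> {fst J<..<snd J} = {};
           (\<Sum>(s,t)\<in>D. t - s) < \<delta>\<rbrakk> \<Longrightarrow> (\<Sum>(s,t)\<in>D. norm (f t - f s)) < \<epsilon>"
    using abs_cont_onD[OF assms(1) \<open>\<epsilon> > 0\<close>] by blast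
  show "\<exists>\<delta>>0. \<forall>D. finite D \<longrightarrow>
             (\<forall>(s, t)\<in>D. c \<le> s \<and> s \<le> t \<and> t \<le> d) \<longrightarrow>
             (\<forall>I\<in>D. \<forall>J\<in>D. I \<noteq> J \<longrightarrow> {fst I<..<snd I} \<inter> {fst J<..<snd J} = {}) \<longrightarrow>
             (\<Sum>(s, t)\<in>D. t - s) < \<delta> \<longrightarrow> (\<Sum>(s, t)\<in>D. norm (f t - f s)) < \<epsilon>"
  proof (intro exI[of _ \<delta>] conjI d allI impI *)
    fix D s t
    assume "\<forall>(s, t)\<in>D. c \<le> s \<and> s \<le> t \<and> t \<le> d" "(s, t) \<in> D"
    then have "c \<le> s \<and> s \<le> t \<and> t \<le> d" by blast
    then show "a \<le> s" "s \<le> t" "t \<le> b" using assms(2,3) by auto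
  qed auto
qed

text \<open>The measure is additive on disjoint open intervals and monotone in the set that contains
  them. This turns a cover by an open set of small measure into the small total length that absolute
  continuity asks for.\<close>

lemma sum_length_disjoint_intervals_le:
  fixes D :: "(real \<times> real) set"
  assumes fin: "finite D" and le: "\<And>s t. (s,t) \<in> D \<Longrightarrow> s \<le> t"
    and disj: "\<And>I J. \<lbrakk>I \<in> D; J \<in> D; I \<noteq> J\<rbrakk> \<Longrightarrow> {fst I<..<snd I} \<inter> {fst J<..<snd J} = {}"
    and sub: "\<And>s t. (s,t) \<in> D \<Longrightarrow> {s<..<t} \<subseteq> G" and G: "G \<in> sets lebesgue"
  shows "ennreal (\<Sum>(s,t)\<in>D. t - s) \<le> emeasure lebesgue G"
proof -
  have "ennreal (\<Sum>(s,t)\<in>D. t - s) = (\<Sum>I\<in>D. ennreal (snd I - fst I))"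
    by (subst sum_ennreal) (use le in \<open>auto simp: case_prod_unfold\<close>)
  also have "\<dots> = (\<Sum>I\<in>D. emeasure lebesgue {fst I<..<snd I})"
    by (intro sum.cong) (use le in auto)
  also have "\<dots> = emeasure lebesgue (\<Union>I\<in>D. {fst I<..<snd I})"
  proof (intro sum_emeasure fin)
    show "disjoint_family_on (\<lambda>I. {fst I<..<snd I}) D"
      unfolding disjoint_family_on_def using disj by blast
  qed auto
  also have "\<dots> \<le> emeasure lebesgue G"
    by (intro emeasure_mono G) (use sub in fastforce)
  finally show ?thesis .
qed

text \<open>Off the exceptional set the gauge comes from differentiability; on it, the gauge confines
  the division to an open set of small measure, where absolute continuity takes over.\<close>
lemma has_integral_vector_derivative_abs_cont:
  fixes f :: "real \<Rightarrow> 'a::banach"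
  assumes ac: "abs_cont_on a b f" and "a \<le> b" and N: "negligible N"
    and deriv: "\<And>t. t \<in> {a..b} - N \<Longrightarrow> (f has_vector_derivative f' t) (at t within {a..b})"
  shows "(f' has_integral (f b - f a)) {a..b}"
proof (rule has_integral_spike[OF N, of _ _ "\<lambda>t. if t \<in> N then 0 else f' t"])
  \<comment> \<open>With the integrand set to 0 on \<open>N\<close>, the tags in \<open>N\<close>
    leave the Riemann sum, and only the increments of \<open>f\<close> over their cells remain to be
    estimated.\<close>
  let ?h = "\<lambda>t. if t \<in> N then 0 else f' t"
  show "(?h has_integral (f b - f a)) {a..b}"
    unfolding has_integral_real
  proof (intro allI impI)
    fix e :: real assume "e > 0"
    \<comment> \<open>The summand 1 keeps the denominator positive when \<open>a = b\<close>. Errors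
      at tags outside \<open>N\<close> will add up to at most \<open>e / 2\<close>; the other half
      is left to the tags in \<open>N\<close>.\<close>
    define e1 where "e1 = e / 2 / (b - a + 1)"
    have e1: "e1 > 0" "e1 * (b - a) \<le> e / 2"
      using \<open>e > 0\<close> \<open>a \<le> b\<close> by (auto simp: e1_def field_simps)
    have "\<exists>d>0. t \<in> {a..b} - N \<longrightarrow>
         (\<forall>y\<in>{a..b}. norm (y-t) < d \<longrightarrow> norm (f y - f t - (y-t) *\<^sub>R f' t) \<le> e1 * norm (y-t))" for t
      using deriv[of t] e1(1) unfolding has_vector_derivative_def has_derivative_within_alt
      by (cases "t \<in> {a..b} - N") (auto intro: zero_less_one)
    then obtain d where d: "\<And>t. 0 < d t"
        "\<And>t y. \<lbrakk>t \<in> {a..b} - N; y \<in> {a..b}; norm (y-t) < d t\<rbrakk>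
            \<Longrightarrow> norm (f y - f t - (y-t) *\<^sub>R f' t) \<le> e1 * norm (y-t)"
      by metis
    obtain \<delta> where \<delta>: "\<delta> > 0" and
      small: "\<And>D. \<lbrakk>finite D; \<And>s t. (s,t) \<in> D \<Longrightarrow> a \<le> s \<and> s \<le> t \<and> t \<le> b;
           \<And>I J. \<lbrakk>I \<in> D; J \<in> D; I \<noteq> J\<rbrakk> \<Longrightarrow> {fst I<..<snd I} \<inter> {fst J<..<snd J} = {};
           (\<Sum>(s,t)\<in>D. t - s) < \<delta>\<rbrakk> \<Longrightarrow> (\<Sum>(s,t)\<in>D. norm (f t - f s)) < e / 2"
      using abs_cont_onD[OF ac, of "e/2"] \<open>e > 0\<close> by (metis half_gt_zero)
    have Nn: "N \<in> null_sets lebesgue"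
      using N by (simp add: negligible_iff_null_sets)
    then obtain G where G: "open G" "N \<subseteq> G" "emeasure lebesgue (G - N) < ennreal \<delta>"
      using sets_lebesgue_outer_open[of N \<delta>] \<delta> by (metis null_setsD2)
    have Gs: "G \<in> sets lebesgue"
      using G(1) by (simp add: borel_open sets_completionI_sets)
    have Gm: "emeasure lebesgue G < ennreal \<delta>"
      using emeasure_Diff_null_set[OF Nn Gs] G(3) by simp
    define \<gamma> where "\<gamma> t = (if t \<in> N then G else ball t (d t))" for t
    have gauge: "gauge \<gamma>"
      unfolding gauge_def \<gamma>_def using G(1,2) d(1) by auto
    have main: "norm ((\<Sum>(t,K)\<in>p. measure lborel K *\<^sub>R ?h t) - (f b - f a)) < e"
      if p: "p tagged_division_of {a..b}" and fine: "\<gamma> fine p" for p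
    proof -
      have fin: "finite p"
        using p by auto
      have K: "\<exists>u v. K = {u..v} \<and> u \<le> t \<and> t \<le> v \<and> a \<le> u \<and> v \<le> b \<and> Inf K = u \<and> Sup K = v \<and> measure lborel K = v - u
                 \<and> {u..v} \<subseteq> \<gamma> t"
        if tK: "(t,K) \<in> p" for t K
      proof -
        obtain u v where "K = {u..v}"
          using tagged_division_ofD(4)[OF p tK] by auto
        then have uv: "K = {u..v}" "t \<in> {u..v}" "{u..v} \<subseteq> {a..b}"
          using tagged_division_ofD(2,3)[OF p tK] by auto
        moreover have "{u..v} \<subseteq> \<gamma> t"
          using fineD[OF fine tK] uv(1) by simp
        ultimately show ?thesis by auto
      qed
      define q where "q = {(t,K) \<in> p. t \<in> N}"
      \<comment> \<open>Degenerate cells contribute nothing. The remaining ones have non-empty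
        disjoint interiors, so passing to the pairs of endpoints is injective and
        \<open>small\<close> applies to the set of these pairs.\<close>
      define r where "r = {(t,K) \<in> q. Inf K < Sup K}"
      let ?I = "\<lambda>(t::real,K::real set). (Inf K, Sup K)"
      have qp: "q \<subseteq> p" "r \<subseteq> q" and finq: "finite q" "finite r"
        using fin by (auto simp: q_def r_def intro: finite_subset[of _ p])
      have disj: "{Inf K<..<Sup K} \<inter> {Inf K'<..<Sup K'} = {}"
        if "(t,K) \<in> p" "(t',K') \<in> p" "(t,K) \<noteq> (t',K')" for t K t' K'
      proof -
        have "interior {Inf K..Sup K} \<inter> interior {Inf K'..Sup K'} = {}"
          using tagged_division_ofD(5)[OF p that] K[OF that(1)] K[OF that(2)] by metis
        then show ?thesis by (simp only: interior_atLeastAtMost_real)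
      qed
      have inj: "inj_on ?I r"
      proof (rule inj_onI, clarify)
        fix t K t' K' assume *: "(t,K) \<in> r" "(t',K') \<in> r" "Inf K = Inf K'" "Sup K = Sup K'"
        then have "{Inf K<..<Sup K} \<inter> {Inf K'<..<Sup K'} \<noteq> {}"
          by (auto simp: r_def)
        with disj[of t K t' K'] * qp show "t = t' \<and> K = K'" by blast
      qed
      have "(\<Sum>(t,K)\<in>q. norm (f (Sup K) - f (Inf K))) = (\<Sum>(t,K)\<in>r. norm (f (Sup K) - f (Inf K)))"
      proof (rule sum.mono_neutral_right[OF finq(1) qp(2)], clarify)
        fix t K assume *: "(t,K) \<in> q" "(t,K) \<notin> r"
        with K[of t K] qp(1) have "Inf K = Sup K"
          unfolding r_def by force
        then show "norm (f (Sup K) - f (Inf K)) = 0" by simp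
      qed
      also have "\<dots> = (\<Sum>(s,t)\<in>?I ` r. norm (f t - f s))"
        by (subst sum.reindex[OF inj]) (auto intro!: sum.cong)
      also have "\<dots> < e / 2"
      proof (rule small)
        show "finite (?I ` r)" using finq by simp
        show *: "a \<le> s \<and> s \<le> t \<and> t \<le> b" if "(s,t) \<in> ?I ` r" for s t
          using that K qp by force
        show **: "{fst I<..<snd I} \<inter> {fst J<..<snd J} = {}"
          if IJ: "I \<in> ?I ` r" "J \<in> ?I ` r" "I \<noteq> J" for I J
        proof -
          obtain t K t' K' where "I = (Inf K, Sup K)" "J = (Inf K', Sup K')"
            "(t,K) \<in> r" "(t',K') \<in> r" using IJ(1,2) by auto
          with disj[of t K t' K'] IJ(3) qp show ?thesis by auto
        qed
        have nn: "0 \<le> (\<Sum>(s,t)\<in>?I ` r. t - s)"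
        proof (rule sum_nonneg)
          fix I assume "I \<in> ?I ` r"
          then have "(fst I, snd I) \<in> ?I ` r" by (simp only: prod.collapse)
          from *[OF this] show "0 \<le> (case I of (s,t) \<Rightarrow> t - s)" by (simp add: case_prod_unfold)
        qed
        have "ennreal (\<Sum>(s,t)\<in>?I ` r. t - s) \<le> emeasure lebesgue G"
        proof (rule sum_length_disjoint_intervals_le[OF _ _ **  _ Gs])
          show "finite (?I ` r)" using finq by simp
          show "s \<le> t" if "(s,t) \<in> ?I ` r" for s t using *[OF that] by simp
          show "{s<..<t} \<subseteq> G" if st: "(s,t) \<in> ?I ` r" for s t
          proof -
            obtain z K where z: "s = Inf K" "t = Sup K" "(z,K) \<in> r" using st by auto
            then have zK: "(z,K) \<in> p" "z \<in> N" using qp by (auto simp: q_def)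
            with K[OF zK(1)] z show ?thesis by (force simp: \<gamma>_def)
          qed
        qed auto
        also have "\<dots> < ennreal \<delta>" by (rule Gm)
        finally show "(\<Sum>(s,t)\<in>?I ` r. t - s) < \<delta>"
          by (simp only: ennreal_less_iff[OF nn])
      qed
      finally have qsum: "(\<Sum>(t,K)\<in>q. norm (f (Sup K) - f (Inf K))) < e / 2" .
      have local: "norm (measure lborel K *\<^sub>R ?h t - (f (Sup K) - f (Inf K))) \<le> e1 * measure lborel K"
        if tK: "(t,K) \<in> p - q" for t K
      proof -
        have "(t,K) \<in> p" "t \<notin> N" using tK by (auto simp: q_def)
        with K[of t K] obtain u v where uv: "K = {u..v}" "u \<le> t" "t \<le> v" "a \<le> u" "v \<le> b"
          "Inf K = u" "Sup K = v" "measure lborel K = v - u" "{u..v} \<subseteq> ball t (d t)"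
          by (auto simp: \<gamma>_def)
        have "u \<in> {u..v}" "v \<in> {u..v}" using uv(2,3) by auto
        then have "u \<in> ball t (d t)" "v \<in> ball t (d t)" using uv(9) by blast+
        then have nuv: "norm (u - t) < d t" "norm (v - t) < d t"
          by (auto simp: dist_norm norm_minus_commute)
        \<comment> \<open>The increment over the cell is split at its tag and the derivative
          estimate is used on either side. The two errors add up to \<open>e1\<close> times the
          length because the tag lies in the cell.\<close>
        have "norm ((v - u) *\<^sub>R f' t - (f v - f u))
            = norm (f u - f t - (u - t) *\<^sub>R f' t - (f v - f t - (v - t) *\<^sub>R f' t))"
          by (auto simp: algebra_simps)
        also have "\<dots> \<le> norm (f u - f t - (u - t) *\<^sub>R f' t) + norm (f v - f t - (v - t) *\<^sub>R f' t)"
          by (rule norm_triangle_ineq4)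
        also have "\<dots> \<le> e1 * norm (u - t) + e1 * norm (v - t)"
          by (intro add_mono d(2)) (use uv nuv \<open>t \<notin> N\<close> in auto)
        also have "\<dots> = e1 * (v - u)"
          using uv by (simp add: algebra_simps)
        finally show ?thesis using uv \<open>t \<notin> N\<close> by simp
      qed
      have fba: "f b - f a = (\<Sum>(t,K)\<in>p. f (Sup K) - f (Inf K))"
        using additive_tagged_division_1[OF \<open>a \<le> b\<close> p, of f] by simp
      have "norm ((\<Sum>(t,K)\<in>p. measure lborel K *\<^sub>R ?h t) - (f b - f a))
          = norm (\<Sum>(t,K)\<in>p. measure lborel K *\<^sub>R ?h t - (f (Sup K) - f (Inf K)))"
        unfolding fba by (simp add: sum_subtractf[symmetric] case_prod_unfold)
      also have "\<dots> = norm ((\<Sum>(t,K)\<in>p - q. measure lborel K *\<^sub>R ?h t - (f (Sup K) - f (Inf K)))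
            + (\<Sum>(t,K)\<in>q. measure lborel K *\<^sub>R ?h t - (f (Sup K) - f (Inf K))))"
        by (subst sum.subset_diff[OF qp(1) fin]) simp
      also have "\<dots> \<le> (\<Sum>(t,K)\<in>p - q. e1 * measure lborel K) + (\<Sum>(t,K)\<in>q. norm (f (Sup K) - f (Inf K)))"
      proof (intro norm_triangle_le add_mono sum_norm_le, goal_cases)
        case (1 z) then show ?case
          using local[of "fst z" "snd z"] by (simp only: case_prod_unfold prod.collapse)
      next
        case (2 z) then show ?case by (auto simp: q_def norm_minus_commute)
      qed
      also have "(\<Sum>(t,K)\<in>p - q. e1 * measure lborel K) \<le> (\<Sum>(t,K)\<in>p. e1 * measure lborel K)"
        using e1(1) by (intro sum_mono2 fin) auto
      also have "\<dots> = e1 * (b - a)"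
        using additive_content_tagged_division[of p a b] p \<open>a \<le> b\<close>
        by (simp add: sum_distrib_left[symmetric] case_prod_unfold)
      finally show ?thesis using e1(2) qsum by linarith
    qed
    show "\<exists>\<gamma>. gauge \<gamma> \<and> (\<forall>p. p tagged_division_of {a..b} \<and> \<gamma> fine p \<longrightarrow>
        norm ((\<Sum>(t,K)\<in>p. measure lborel K *\<^sub>R ?h t) - (f b - f a)) < e)"
      using gauge main by (intro exI[of _ \<gamma>] conjI allI impI) auto
  qed
qed auto

text \<open>A strictly increasing map carries non-overlapping intervals injectively to
  non-overlapping intervals, and the Lipschitz bound stretches their total length by at most
  \<open>K\<close>. Hence \<open>\<delta> / K\<close> serves for the composition when
  \<open>\<delta>\<close> serves for \<open>x\<close>.\<close>

lemma abs_cont_on_compose_strict_mono: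
  fixes x :: "real \<Rightarrow> 'a::real_normed_vector"
  assumes x: "abs_cont_on a b x" and mono: "strict_mono \<tau>"
    and ends: "a \<le> \<tau> c" "\<tau> d \<le> b"
    and lip: "\<And>r r'. \<bar>\<tau> r - \<tau> r'\<bar> \<le> K * \<bar>r - r'\<bar>" and K: "K > 0"
  shows "abs_cont_on c d (\<lambda>r. x (\<tau> r))"
  unfolding abs_cont_on_def
proof (intro allI impI)
  fix \<epsilon> :: real assume "\<epsilon> > 0"
  obtain \<delta> where d: "\<delta> > 0" and
    *: "\<And>D. \<lbrakk>finite D; \<And>s t. (s,t) \<in> D \<Longrightarrow> a \<le> s \<and> s \<le> t \<and> t \<le> b;
           \<And>I J. \<lbrakk>I \<in> D; J \<in> D; I \<noteq> J\<rbrakk> \<Longrightarrow> {fst I<..<snd I} \<inter> {fst J<..<snd J} = {};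
           (\<Sum>(s,t)\<in>D. t - s) < \<delta>\<rbrakk> \<Longrightarrow> (\<Sum>(s,t)\<in>D. norm (x t - x s)) < \<epsilon>"
    using abs_cont_onD[OF x \<open>\<epsilon> > 0\<close>] by blast
  show "\<exists>\<delta>>0. \<forall>D. finite D \<longrightarrow>
             (\<forall>(s, t)\<in>D. c \<le> s \<and> s \<le> t \<and> t \<le> d) \<longrightarrow>
             (\<forall>I\<in>D. \<forall>J\<in>D. I \<noteq> J \<longrightarrow> {fst I<..<snd I} \<inter> {fst J<..<snd J} = {}) \<longrightarrow>
             (\<Sum>(s, t)\<in>D. t - s) < \<delta> \<longrightarrow> (\<Sum>(s, t)\<in>D. norm (x (\<tau> t) - x (\<tau> s))) < \<epsilon>"
  proof (intro exI[of _ "\<delta> / K"] conjI allI impI)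
    show "\<delta> / K > 0" using d K by simp
    fix D :: "(real \<times> real) set"
    assume fin: "finite D" and D: "\<forall>(s, t)\<in>D. c \<le> s \<and> s \<le> t \<and> t \<le> d"
      and disj: "\<forall>I\<in>D. \<forall>J\<in>D. I \<noteq> J \<longrightarrow> {fst I<..<snd I} \<inter> {fst J<..<snd J} = {}"
      and sum: "(\<Sum>(s, t)\<in>D. t - s) < \<delta> / K"
    let ?T = "map_prod \<tau> \<tau>"
    have le: "\<tau> s \<le> \<tau> t \<longleftrightarrow> s \<le> t" and less: "\<tau> s < \<tau> t \<longleftrightarrow> s < t" for s t
      using mono by (simp_all add: strict_mono_less_eq strict_mono_less)
    have inj: "inj_on ?T D"
      using strict_mono_eq[OF mono] by (auto simp: inj_on_def)
    have "(\<Sum>(s,t)\<in>?T ` D. norm (x t - x s)) < \<epsilon>"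
    proof (rule *)
      show "finite (?T ` D)" using fin by simp
      show "a \<le> s \<and> s \<le> t \<and> t \<le> b" if st: "(s,t) \<in> ?T ` D" for s t
      proof -
        obtain s' t' where e: "s = \<tau> s'" "t = \<tau> t'" "(s',t') \<in> D" using st by auto
        with D have "c \<le> s'" "s' \<le> t'" "t' \<le> d" by auto
        then have "\<tau> c \<le> s" "s \<le> t" "t \<le> \<tau> d" unfolding e(1,2) le by auto
        with ends show ?thesis by linarith
      qed
      show "{fst I<..<snd I} \<inter> {fst J<..<snd J} = {}"
        if IJ: "I \<in> ?T ` D" "J \<in> ?T ` D" "I \<noteq> J" for I J
      proof -
        obtain s t s' t' where e: "I = (\<tau> s, \<tau> t)" "J = (\<tau> s', \<tau> t')" "(s,t) \<in> D" "(s',t') \<in> D"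
          using IJ by auto
        with IJ(3) have "(s,t) \<noteq> (s',t')" by auto
        with disj e have "{s<..<t} \<inter> {s'<..<t'} = {}" by fastforce
        \<comment> \<open>Disjointness of open intervals becomes an inequality between endpoints, a
          form that an increasing map preserves.\<close>
        then have "min t t' \<le> max s s'" by simp
        then have "min (\<tau> t) (\<tau> t') \<le> max (\<tau> s) (\<tau> s')"
          by (auto simp: min_le_iff_disj le_max_iff_disj le)
        then show ?thesis using e by simp
      qed
      have "(\<Sum>(s,t)\<in>?T ` D. t - s) = (\<Sum>(s,t)\<in>D. \<tau> t - \<tau> s)"
        by (subst sum.reindex[OF inj]) (auto intro!: sum.cong)
      also have "\<dots> \<le> (\<Sum>(s,t)\<in>D. K * (t - s))"
      proof (rule sum_mono, clarify)
        fix s t assume "(s,t) \<in> D"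
        with D have "s \<le> t" by auto
        then show "\<tau> t - \<tau> s \<le> K * (t - s)" using lip[of t s] by simp
      qed
      also have "\<dots> = K * (\<Sum>(s,t)\<in>D. t - s)"
        by (simp add: sum_distrib_left case_prod_unfold)
      also have "\<dots> < \<delta>" using sum K by (simp add: field_simps)
      finally show "(\<Sum>(s,t)\<in>?T ` D. t - s) < \<delta>" .
    qed
    also have "(\<Sum>(s,t)\<in>?T ` D. norm (x t - x s)) = (\<Sum>(s, t)\<in>D. norm (x (\<tau> t) - x (\<tau> s)))"
      by (subst sum.reindex[OF inj]) (auto intro!: sum.cong)
    finally show "(\<Sum>(s, t)\<in>D. norm (x (\<tau> t) - x (\<tau> s))) < \<epsilon>" .
  qed
qed

section \<open>Changes of time\<close>

text \<open>The library provides one-sided Lebesgue points only; the left derivative comes from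
  reflecting \<open>f\<close>.\<close>
lemma integral_has_real_derivative_ae:
  fixes f F :: "real \<Rightarrow> real"
  assumes f: "\<And>a b. f integrable_on {a..b}"
    and F: "\<And>a b. a \<le> b \<Longrightarrow> F b - F a = integral {a..b} f"
  obtains N where "negligible N" "\<And>x. x \<notin> N \<Longrightarrow> (F has_real_derivative f x) (at x)"
proof -
  obtain N1 where N1: "negligible N1" "\<And>x e. \<lbrakk>x \<notin> N1; 0 < e\<rbrakk> \<Longrightarrow> \<exists>d>0. \<forall>h. 0 < h \<and> h < d \<longrightarrow>
        norm (integral {x..x + h} f / h - f x) < e"
    using integrable_ccontinuous_explicit[where f=f] f by (auto simp: divide_inverse mult.commute)
  have f': "(\<lambda>x. f (- x)) integrable_on {a..b}" for a b
    using f[of "-b" "-a"] Henstock_Kurzweil_Integration.integrable_reflect_real[where f=f and a="-b" and b="-a"] by simp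
  obtain N2 where N2: "negligible N2" "\<And>x e. \<lbrakk>x \<notin> N2; 0 < e\<rbrakk> \<Longrightarrow> \<exists>d>0. \<forall>h. 0 < h \<and> h < d \<longrightarrow>
        norm (integral {x..x + h} (\<lambda>x. f (- x)) / h - f (- x)) < e"
    using integrable_ccontinuous_explicit[where f="\<lambda>x. f (- x)"] f' by (auto simp: divide_inverse mult.commute)
  show thesis
  proof (rule that[of "N1 \<union> uminus ` N2"])
    have "negligible (uminus ` N2)"
      by (rule negligible_differentiable_image_negligible[OF order_refl N2(1)])
        (auto intro!: derivative_intros)
    with N1 show "negligible (N1 \<union> uminus ` N2)" by simp
    fix x assume "x \<notin> N1 \<union> uminus ` N2"
    then have x: "x \<notin> N1" "- x \<notin> N2" by force+
    show "(F has_real_derivative f x) (at x)"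
      unfolding DERIV_def
    proof (rule LIM_I)
      fix e :: real assume e: "e > 0"
      obtain d1 where d1: "d1 > 0" "\<And>h. \<lbrakk>0 < h; h < d1\<rbrakk> \<Longrightarrow> norm (integral {x..x + h} f / h - f x) < e"
        using N1(2)[OF x(1) e] by blast
      obtain d2 where d2: "d2 > 0"
        "\<And>h. \<lbrakk>0 < h; h < d2\<rbrakk> \<Longrightarrow> norm (integral {-x..-x + h} (\<lambda>x. f (- x)) / h - f x) < e"
        using N2(2)[OF x(2) e] by auto
      show "\<exists>s>0. \<forall>h::real. h \<noteq> 0 \<and> norm (h - 0) < s \<longrightarrow> norm ((F (x + h) - F x) / h - f x) < e"
      proof (intro exI[of _ "min d1 d2"] conjI allI impI)
        fix h :: real assume h: "h \<noteq> 0 \<and> norm (h - 0) < min d1 d2"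
        show "norm ((F (x + h) - F x) / h - f x) < e"
        proof (cases "h > 0")
          case True
          then show ?thesis using d1(2)[of h] h F[of x "x + h"] by simp
        next
          case False
          have "integral {-x..-x + - h} (\<lambda>x. f (- x)) = integral {x + h..x} f"
            using Henstock_Kurzweil_Integration.integral_reflect_real[of x "x + h" f] by (simp add: add.commute)
          also have "\<dots> = F x - F (x + h)" using F[of "x + h" x] False h by simp
          finally have "integral {-x..-x + - h} (\<lambda>x. f (- x)) / (- h) = (F (x + h) - F x) / h"
            by (simp add: divide_simps)
          then show ?thesis using d2(2)[of "- h"] h False by simp
        qed
      qed (use d1 d2 in auto)
    qed
  qed
qed

text \<open>\<open>\<tau>\<close> is the inverse of the primitive of \<open>w\<close> that vanishes
  at 0. The lower bound on \<open>w\<close> makes this inverse Lipschitz, and the integral of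
  \<open>w\<close> makes it fix 1. The last conclusion is the substitution rule
  \<open>dr = w dt\<close> as an identity of measures; it transports integrals and null sets
  alike.\<close>

lemma time_change:
  fixes w :: "real \<Rightarrow> real"
  assumes wb[measurable]: "w \<in> borel_measurable borel"
    and w: "\<And>t. c \<le> w t" "\<And>t. w t \<le> C" and c: "0 < c"
    and w1: "(w has_integral 1) {0..1}"
  obtains \<tau> where "strict_mono \<tau>" "\<tau> 0 = 0" "\<tau> 1 = 1" "\<And>r r'. \<bar>\<tau> r - \<tau> r'\<bar> \<le> \<bar>r - r'\<bar> / c"
    "AE r in lborel. (\<tau> has_real_derivative 1 / w (\<tau> r)) (at r)"
    "\<tau> \<in> borel_measurable borel"
    "distr lborel borel \<tau> = density lborel w"
proof -
  have wint: "w integrable_on {a..b}" for a b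
  proof (rule measurable_bounded_by_integrable_imp_integrable)
    show "w \<in> borel_measurable (lebesgue_on {a..b})"
      by (intro borel_measurable_if_I measurable_restrict_space1 measurable_completion) simp
    show "(\<lambda>x. C) integrable_on {a..b}" by (rule integrable_const_ivl)
    show "norm (w x) \<le> C" for x using w[of x] c by simp
  qed auto
  \<comment> \<open>Integrals over reversed intervals vanish, so at most one of the two terms is
    active: this is the signed primitive on the whole line.\<close>
  define s where "s t = integral {0..t} w - integral {t..0} w" for t
  have s_diff: "s b - s a = integral {a..b} w" if "a \<le> b" for a b
  proof -
    have *: "integral {x..y} w + integral {y..z} w = integral {x..z} w" if "x \<le> y" "y \<le> z" for x y z
      by (rule Henstock_Kurzweil_Integration.integral_combine[OF that wint])
    have [simp]: "integral {x..y} w = 0" if "y \<le> x" for x y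
      using that by (cases "x = y") auto
    consider "0 \<le> a" | "a < 0" "0 \<le> b" | "b < 0" by linarith
    then show ?thesis
      by cases (use that *[of 0 a b] *[of a 0 b] *[of a b 0] in \<open>simp_all add: s_def\<close>)
  qed
  have s_bounds: "c * (b - a) \<le> s b - s a" "s b - s a \<le> C * (b - a)" if "a \<le> b" for a b
  proof -
    have 1: "((\<lambda>t. k) has_integral (k * (b - a))) {a..b}" for k
      using has_integral_const_real[of k a b] that by (simp add: mult.commute)
    have 2: "(w has_integral (s b - s a)) {a..b}"
      using s_diff[OF that] wint by (metis has_integral_integral)
    show "c * (b - a) \<le> s b - s a" using has_integral_le[OF 1 2] w(1) by blast
    show "s b - s a \<le> C * (b - a)" using has_integral_le[OF 2 1] w(2) by blast
  qed
  have mono: "strict_mono s"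
  proof (rule strict_monoI)
    fix a b :: real assume "a < b"
    then show "s a < s b" using s_bounds(1)[of a b] c mult_pos_pos[of c "b - a"] by linarith
  qed
  have s0: "s 0 = 0" and s1: "s 1 = 1"
    using w1 by (auto simp: s_def integral_unique)
  have C: "C > 0" using w[of 0] c by linarith
  have s_cont: "continuous_on UNIV s"
  proof (rule lipschitz_on_continuous_on)
    have "\<bar>s x - s y\<bar> \<le> C * \<bar>x - y\<bar>" for x y
      using s_bounds[of x y] s_bounds[of y x] strict_mono_less_eq[OF mono, of x y]
        strict_mono_less_eq[OF mono, of y x]
      by (cases "x \<le> y") auto
    then show "C-lipschitz_on UNIV s"
      using C by (intro lipschitz_onI) (auto simp: dist_real_def)
  qed
  have surj: "\<exists>t. s t = r" for r
  proof -
    \<comment> \<open>The slope of \<open>s\<close> is at least \<open>c\<close>, so the value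
      \<open>r\<close> is reached within distance \<open>\<bar>r\<bar> / c\<close> of 0.\<close>
    have "r \<le> s (\<bar>r\<bar> / c)" "s (- (\<bar>r\<bar> / c)) \<le> r"
      using s_bounds(1)[of 0 "\<bar>r\<bar> / c"] s_bounds(1)[of "- (\<bar>r\<bar> / c)" 0] s0 c by auto
    then show ?thesis
      using IVT'[of s "- (\<bar>r\<bar> / c)" r "\<bar>r\<bar> / c"] continuous_on_subset[OF s_cont] c by auto
  qed
  define \<tau> where "\<tau> = inv s"
  have s\<tau>: "s (\<tau> r) = r" for r
    unfolding \<tau>_def using surj by (metis f_inv_into_f rangeI)
  have \<tau>s: "\<tau> (s t) = t" for t
    unfolding \<tau>_def by (rule inv_f_f) (rule strict_mono_imp_inj_on[OF mono])
  have \<tau>_mono: "strict_mono \<tau>"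
    using strict_mono_less[OF mono] s\<tau> by (auto intro!: strict_monoI) (metis)
  have \<tau>_lip: "\<bar>\<tau> r - \<tau> r'\<bar> \<le> \<bar>r - r'\<bar> / c" for r r'
  proof -
    have *: "c * (\<tau> b - \<tau> a) \<le> b - a" if "\<tau> a \<le> \<tau> b" for a b
      using s_bounds(1)[OF that] by (simp add: s\<tau>)
    have "c * \<bar>\<tau> r - \<tau> r'\<bar> \<le> \<bar>r - r'\<bar>"
      using *[of r r'] *[of r' r] by (cases "\<tau> r \<le> \<tau> r'") auto
    then show ?thesis using c by (simp add: field_simps)
  qed
  have \<tau>_cont: "continuous_on UNIV \<tau>"
  proof (rule lipschitz_on_continuous_on)
    show "(1/c)-lipschitz_on UNIV \<tau>"
      using c \<tau>_lip by (intro lipschitz_onI) (auto simp: dist_real_def)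
  qed
  have [measurable]: "\<tau> \<in> borel_measurable borel" "s \<in> borel_measurable borel"
    using \<tau>_cont s_cont by (auto intro: borel_measurable_continuous_onI)
  \<comment> \<open>Lebesgue measure is determined by its values on boxes. The preimage of an
    interval under \<open>s\<close> has as its \<open>w\<close>-mass the increment of
    \<open>s\<close>, which is the length of the interval.\<close>
  have push: "lborel = distr (density lborel w) borel s"
  proof (rule lborel_eqI)
    fix l u :: real assume "\<And>b. b \<in> Basis \<Longrightarrow> l \<bullet> b \<le> u \<bullet> b"
    then have lu: "l \<le> u" by simp
    have le: "\<tau> l \<le> \<tau> u" using lu \<tau>_mono by (simp add: strict_mono_less_eq)
    have vim: "s -` {l<..<u} = {\<tau> l<..<\<tau> u}"
      using strict_mono_less[OF mono] s\<tau> by (auto simp: vimage_def) (metis)+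
    have "(w has_integral (s (\<tau> u) - s (\<tau> l))) {\<tau> l..\<tau> u}"
      using s_diff[OF le] wint by (metis has_integral_integral)
    then have hi: "(w has_integral (u - l)) {\<tau> l<..<\<tau> u}"
      by (simp add: s\<tau> has_integral_Icc_iff_Ioo)
    have "emeasure (distr (density lborel w) borel s) (box l u)
        = (\<integral>\<^sup>+ t. ennreal (w t) * indicator {\<tau> l<..<\<tau> u} t \<partial>lborel)"
      by (simp add: emeasure_distr emeasure_density vim)
    also have "\<dots> = ennreal (u - l)"
      using w c by (intro nn_integral_has_integral_lebesgue' hi) (meson less_le_trans less_imp_le)
    finally show "emeasure (distr (density lborel w) borel s) (box l u) = (\<Prod>b\<in>Basis. (u - l) \<bullet> b)"
      by simp
  qed simp
  have distr: "distr lborel borel \<tau> = density lborel w"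
  proof -
    have "distr lborel borel \<tau> = distr (density lborel w) borel (\<tau> \<circ> s)"
      by (subst push, subst distr_distr) auto
    also have "\<tau> \<circ> s = (\<lambda>t. t)" using \<tau>s by auto
    also have "distr (density lborel w) borel (\<lambda>t. t) = density lborel w"
      by (rule distr_id2) simp
    finally show ?thesis .
  qed
  obtain N where N: "negligible N" "\<And>x. x \<notin> N \<Longrightarrow> (s has_real_derivative w x) (at x)"
    using integral_has_real_derivative_ae[OF wint s_diff] by blast
  have "AE t in lebesgue. t \<notin> N"
    using N(1) by (simp add: AE_not_in negligible_iff_null_sets)
  then have "AE t in lborel. (s has_real_derivative w t) (at t)"
    unfolding AE_completion_iff by eventually_elim (rule N(2))
  \<comment> \<open>The image of Lebesgue measure under \<open>\<tau>\<close> has a density, so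
    Lebesgue null sets are null for it. The times at which \<open>s\<close> fails to have derivative
    \<open>w\<close> therefore pull back to a null set of \<open>r\<close>.\<close>
  then have "AE t in distr lborel borel \<tau>. (s has_real_derivative w t) (at t)"
    unfolding distr by (subst AE_density) auto
  then have "AE r in lborel. (s has_real_derivative w (\<tau> r)) (at (\<tau> r))"
    by (rule AE_distrD[rotated]) simp
  then have deriv: "AE r in lborel. (\<tau> has_real_derivative 1 / w (\<tau> r)) (at r)"
  proof eventually_elim
    case (elim r)
    have "w (\<tau> r) \<noteq> 0" using w(1)[of "\<tau> r"] c by linarith
    moreover have "isCont \<tau> r" using \<tau>_cont by (simp add: continuous_on_eq_continuous_at)
    ultimately have "(\<tau> has_real_derivative inverse (w (\<tau> r))) (at r)"
      using DERIV_inverse_function[of s "w (\<tau> r)" \<tau> r "r - 1" "r + 1", OF elim] s\<tau> by auto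
    then show ?case by (simp add: divide_inverse)
  qed
  show thesis
    by (rule that[OF \<tau>_mono _ _ \<tau>_lip deriv _ distr]) (use \<tau>s[of 0] \<tau>s[of 1] s0 s1 in auto)
qed

section \<open>Admissible processes\<close>

text \<open>Each coordinate, extended by zero off \<open>S\<close>, agrees almost everywhere with a
  Borel function. A Borel control can then be composed with a time change and with \<open>L\<close>
  by the standard measurability rules.\<close>

lemma lebesgue_on_ex_borel_measurable:
  fixes u :: "'a::euclidean_space \<Rightarrow> 'b::euclidean_space"
  assumes u: "u \<in> borel_measurable (lebesgue_on S)" and S: "S \<in> sets lebesgue"
  obtains v where "v \<in> borel_measurable borel" "AE t in lebesgue. t \<in> S \<longrightarrow> v t = u t"
proof -
  let ?u = "\<lambda>b t. if t \<in> S then u t \<bullet> b else 0"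
  have "\<exists>g. g \<in> borel_measurable borel \<and> (AE t in lborel. ?u b t = g t)" for b
  proof -
    have "(\<lambda>t. u t \<bullet> b) \<in> borel_measurable (lebesgue_on S)"
      using u by simp
    then have "?u b \<in> borel_measurable lebesgue"
      by (rule borel_measurable_if_I[OF _ S])
    from completion_ex_borel_measurable_real[OF this] obtain g'
      where "g' \<in> borel_measurable lborel" "AE t in lborel. ?u b t = g' t" by blast
    then show ?thesis by (intro exI[of _ g'] conjI) (simp_all only: measurable_lborel2)
  qed
  then have "\<exists>g. \<forall>b. g b \<in> borel_measurable borel \<and> (AE t in lborel. ?u b t = g b t)"
    by (intro choice allI)
  then obtain g where g: "\<And>b. g b \<in> borel_measurable borel" "\<And>b. AE t in lborel. ?u b t = g b t"
    by blast
  show thesis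
  proof
    show "(\<lambda>t. \<Sum>b\<in>Basis. g b t *\<^sub>R b) \<in> borel_measurable borel"
      using g(1) by simp
    have "AE t in lborel. \<forall>b\<in>(Basis::'b set). ?u b t = g b t"
      using g(2) by (intro AE_finite_allI) auto
    then have "AE t in lebesgue. \<forall>b\<in>(Basis::'b set). ?u b t = g b t"
      by (rule AE_completion)
    then show "AE t in lebesgue. t \<in> S \<longrightarrow> (\<Sum>b\<in>Basis. g b t *\<^sub>R b) = u t"
    proof eventually_elim
      case (elim t)
      show ?case
      proof
        assume "t \<in> S"
        then have "(\<Sum>b\<in>Basis. g b t *\<^sub>R b) = (\<Sum>b\<in>Basis. (u t \<bullet> b) *\<^sub>R b)"
          using elim by (intro sum.cong) auto
        then show "(\<Sum>b\<in>Basis. g b t *\<^sub>R b) = u t"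
          by (simp add: euclidean_representation)
      qed
    qed
  qed
qed

lemma nn_integral_lebesgue_on:
  "S \<in> sets lebesgue \<Longrightarrow> (\<integral>\<^sup>+ t. f t \<partial>lebesgue_on S) = (\<integral>\<^sup>+ t. f t * indicator S t \<partial>lborel)"
  by (simp add: nn_integral_restrict_space nn_integral_completion)

lemma cost_eq_nn_integral_lborel:
  "cost L u x = (\<integral>\<^sup>+ t. ennreal (L (x t) (u t)) * indicator {0..1} t \<partial>lborel)"
  unfolding cost_def by (rule nn_integral_lebesgue_on) simp

text \<open>Integrability, the differential equation and the cost see the control only up to null
  sets, so the control of a solution may be taken Borel.\<close>

lemma is_solution_cong_AE:
  fixes u v :: "real \<Rightarrow> real^'m"
  assumes sol: "is_solution L g u x" and v: "v \<in> borel_measurable borel"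
    and eq: "AE t in lebesgue. t \<in> {0..1} \<longrightarrow> v t = u t"
  shows "is_solution L g v x"
proof -
  have adm: "admissible g u x" using sol by (simp add: is_solution_def)
  have vm: "v \<in> borel_measurable (lebesgue_on {0..1})"
    using v by (intro measurable_restrict_space1 measurable_completion) simp
  have eq': "AE t in lebesgue_on {0..1}. v t = u t"
    using eq by (simp add: AE_restrict_space_iff)
  have "integrable (lebesgue_on {0..1}) u" using adm by (simp add: admissible_def)
  then have "integrable (lebesgue_on {0..1}) v"
    using eq' vm by (subst integrable_cong_AE) (auto dest: borel_measurable_integrable)
  moreover have "AE t in lebesgue. t \<in> {0..1} \<longrightarrow>
        (x has_vector_derivative (g (x t) *v v t)) (at t within {0..1})"
  proof -
    have "AE t in lebesgue. t \<in> {0..1} \<longrightarrow>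
        (x has_vector_derivative (g (x t) *v u t)) (at t within {0..1})"
      using adm by (simp add: admissible_def)
    with eq show ?thesis by eventually_elim auto
  qed
  ultimately have "admissible g v x"
    using adm by (simp add: admissible_def)
  moreover have "cost L v x = cost L u x"
    unfolding cost_def using eq' by (intro nn_integral_cong_AE) (auto elim: eventually_mono)
  ultimately show ?thesis using sol by (simp add: is_solution_def)
qed

text \<open>The new process is \<open>x \<circ> \<tau>\<close> with control
  \<open>(u / w) \<circ> \<tau>\<close>. The chain rule produces a factor \<open>1 / w\<close>,
  which the control absorbs because the dynamics are linear in it; as \<open>g\<close> and
  \<open>L\<close> do not depend on time, nothing else changes. The cost formula is the substitution
  \<open>dr = w dt\<close>.\<close>

lemma time_change_admissible:
  fixes L :: "real^'n \<Rightarrow> real^'m \<Rightarrow> real" and u :: "real \<Rightarrow> real^'m"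
  assumes L: "continuous_on UNIV (\<lambda>(x,u). L x u)"
    and adm: "admissible g u x" and ub[measurable]: "u \<in> borel_measurable borel"
    and wb[measurable]: "w \<in> borel_measurable borel"
    and w: "\<And>t. c \<le> w t" "\<And>t. w t \<le> C" and c: "0 < c"
    and w1: "(w has_integral 1) {0..1}"
  obtains v y where "admissible g v y"
    "cost L v y = (\<integral>\<^sup>+ t. ennreal (w t * L (x t) (u t /\<^sub>R w t)) * indicator {0..1} t \<partial>lborel)"
proof -
  obtain \<tau> where \<tau>: "strict_mono \<tau>" "\<tau> 0 = 0" "\<tau> 1 = 1"
    "\<And>r r'. \<bar>\<tau> r - \<tau> r'\<bar> \<le> \<bar>r - r'\<bar> / c"
    "AE r in lborel. (\<tau> has_real_derivative 1 / w (\<tau> r)) (at r)"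
    "\<tau> \<in> borel_measurable borel"
    "distr lborel borel \<tau> = density lborel w"
    using time_change[OF wb w c w1] by blast
  note [measurable] = \<tau>(6)
  have wpos: "0 < w t" for t using w(1)[of t] c by linarith
  have subst: "(\<integral>\<^sup>+ r. h (\<tau> r) \<partial>lborel) = (\<integral>\<^sup>+ t. ennreal (w t) * h t \<partial>lborel)"
    if [measurable]: "h \<in> borel_measurable borel" for h :: "real \<Rightarrow> ennreal"
  proof -
    have "(\<integral>\<^sup>+ r. h (\<tau> r) \<partial>lborel) = (\<integral>\<^sup>+ t. h t \<partial>distr lborel borel \<tau>)"
      by (subst nn_integral_distr) auto
    also have "\<dots> = (\<integral>\<^sup>+ t. ennreal (w t) * h t \<partial>lborel)"
      unfolding \<tau>(7) by (subst nn_integral_density) auto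
    finally show ?thesis .
  qed
  have unit: "\<tau> r \<in> {0..1} \<longleftrightarrow> r \<in> {0..1}" for r
    using strict_mono_less_eq[OF \<tau>(1), of 0 r] strict_mono_less_eq[OF \<tau>(1), of r 1] \<tau>(2,3) by simp
  have ind: "indicator {0..1} (\<tau> r) = (indicator {0..1} r :: ennreal)" for r
    using unit[of r] by (simp only: indicator_def)
  define v where "v r = u (\<tau> r) /\<^sub>R w (\<tau> r)" for r
  have [measurable]: "v \<in> borel_measurable borel" unfolding v_def by measurable
  define z where "z t = x (max 0 (min 1 t))" for t
  have z: "z t = x t" if "t \<in> {0..1}" for t using that by (simp add: z_def)
  have [measurable]: "z \<in> borel_measurable borel"
    unfolding z_def using adm by (intro borel_measurable_abs_cont_on_clamp) (auto simp: admissible_def)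
  have iu: "integrable (lebesgue_on {0..1}) u" and ac: "abs_cont_on 0 1 x" and x0: "x 0 = 0"
    and dx: "AE t in lebesgue. t \<in> {0..1} \<longrightarrow>
        (x has_vector_derivative (g (x t) *v u t)) (at t within {0..1})"
    using adm by (auto simp: admissible_def)
  have "integrable (lebesgue_on {0..1}) v"
  proof (rule integrableI_bounded)
    show "v \<in> borel_measurable (lebesgue_on {0..1})"
      by (intro measurable_restrict_space1 measurable_completion) simp
    have "(\<integral>\<^sup>+ r. ennreal (norm (v r)) \<partial>lebesgue_on {0..1})
        = (\<integral>\<^sup>+ r. ennreal (norm (u (\<tau> r) /\<^sub>R w (\<tau> r))) * indicator {0..1} (\<tau> r) \<partial>lborel)"
      by (subst nn_integral_lebesgue_on) (simp_all add: v_def ind)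
    also have "\<dots> = (\<integral>\<^sup>+ t. ennreal (w t) * (ennreal (norm (u t /\<^sub>R w t)) * indicator {0..1} t) \<partial>lborel)"
      by (rule subst) measurable
    \<comment> \<open>The density \<open>w\<close> cancels the factor \<open>1 / w\<close> of the
      control, so \<open>v\<close> and \<open>u\<close> have the same integral norm.\<close>
    also have "\<dots> = (\<integral>\<^sup>+ t. ennreal (norm (u t)) * indicator {0..1} t \<partial>lborel)"
    proof (rule nn_integral_cong)
      fix t
      have "ennreal (w t) * ennreal (norm (u t /\<^sub>R w t)) = ennreal (norm (u t))"
        using wpos[of t] by (simp add: ennreal_mult[symmetric])
      then show "ennreal (w t) * (ennreal (norm (u t /\<^sub>R w t)) * indicator {0..1} t)
          = ennreal (norm (u t)) * indicator {0..1} t"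
        by (simp add: mult.assoc[symmetric])
    qed
    also have "\<dots> = (\<integral>\<^sup>+ t. ennreal (norm (u t)) \<partial>lebesgue_on {0..1})"
      by (subst nn_integral_lebesgue_on) simp_all
    also have "\<dots> < \<infinity>"
      using iu by (simp add: integrable_iff_bounded)
    finally show "(\<integral>\<^sup>+ r. ennreal (norm (v r)) \<partial>lebesgue_on {0..1}) < \<infinity>" .
  qed
  moreover have "abs_cont_on 0 1 (\<lambda>r. x (\<tau> r))"
    by (rule abs_cont_on_compose_strict_mono[OF ac \<tau>(1), where K="1/c"])
      (use \<tau> c in \<open>auto simp: field_simps\<close>)
  moreover have "AE r in lebesgue. r \<in> {0..1} \<longrightarrow>
        ((\<lambda>r. x (\<tau> r)) has_vector_derivative (g (x (\<tau> r)) *v v r)) (at r within {0..1})"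
  proof (rule AE_completion)
    have "AE t in lborel. t \<in> {0..1} \<longrightarrow>
        (x has_vector_derivative (g (x t) *v u t)) (at t within {0..1})"
      using dx by (simp add: AE_completion_iff)
    then have "AE t in distr lborel borel \<tau>. t \<in> {0..1} \<longrightarrow>
        (x has_vector_derivative (g (x t) *v u t)) (at t within {0..1})"
      unfolding \<tau>(7) by (subst AE_density) auto
    then have "AE r in lborel. \<tau> r \<in> {0..1} \<longrightarrow>
        (x has_vector_derivative (g (x (\<tau> r)) *v u (\<tau> r))) (at (\<tau> r) within {0..1})"
      by (rule AE_distrD[rotated]) simp
    with \<tau>(5) show "AE r in lborel. r \<in> {0..1} \<longrightarrow>
        ((\<lambda>r. x (\<tau> r)) has_vector_derivative (g (x (\<tau> r)) *v v r)) (at r within {0..1})"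
    proof eventually_elim
      case (elim r)
      show ?case
      proof
        assume r: "r \<in> {0..1}"
        have 1: "(\<tau> has_vector_derivative 1 / w (\<tau> r)) (at r within {0..1})"
          using elim(1) by (simp add: has_real_derivative_iff_has_vector_derivative
              has_vector_derivative_at_within)
        have "(x has_vector_derivative (g (x (\<tau> r)) *v u (\<tau> r))) (at (\<tau> r) within \<tau> ` {0..1})"
          using elim(2) r unit by (auto intro: has_vector_derivative_within_subset)
        from vector_diff_chain_within[OF 1 this]
        show "((\<lambda>r. x (\<tau> r)) has_vector_derivative (g (x (\<tau> r)) *v v r)) (at r within {0..1})"
          by (simp add: o_def v_def matrix_vector_mult_scaleR divide_inverse)
      qed
    qed
  qed
  ultimately have "admissible g v (\<lambda>r. x (\<tau> r))"
    using x0 \<tau>(2) by (simp add: admissible_def)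
  moreover have "cost L v (\<lambda>r. x (\<tau> r))
      = (\<integral>\<^sup>+ t. ennreal (w t * L (x t) (u t /\<^sub>R w t)) * indicator {0..1} t \<partial>lborel)"
  proof -
    have [measurable]: "(\<lambda>t. L (z t) (u t /\<^sub>R w t)) \<in> borel_measurable borel"
      using borel_measurable_continuous_Pair[OF _ _ L[unfolded case_prod_unfold], of z borel "\<lambda>t. u t /\<^sub>R w t"] by simp
    have "cost L v (\<lambda>r. x (\<tau> r))
        = (\<integral>\<^sup>+ r. ennreal (L (x (\<tau> r)) (v r)) * indicator {0..1} r \<partial>lborel)"
      by (rule cost_eq_nn_integral_lborel)
    also have "\<dots> = (\<integral>\<^sup>+ r. ennreal (L (z (\<tau> r)) (u (\<tau> r) /\<^sub>R w (\<tau> r))) * indicator {0..1} (\<tau> r) \<partial>lborel)"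
      by (intro nn_integral_cong) (use unit z in \<open>auto simp: v_def split: split_indicator\<close>)
    also have "\<dots> = (\<integral>\<^sup>+ t. ennreal (w t) * (ennreal (L (z t) (u t /\<^sub>R w t)) * indicator {0..1} t) \<partial>lborel)"
      by (rule subst) measurable
    also have "\<dots> = (\<integral>\<^sup>+ t. ennreal (w t * L (x t) (u t /\<^sub>R w t)) * indicator {0..1} t \<partial>lborel)"
      by (intro nn_integral_cong)
        (use z wpos in \<open>auto simp: ennreal_mult' less_imp_le split: split_indicator\<close>)
    finally show ?thesis .
  qed
  ultimately show thesis by (rule that)
qed

section \<open>The energy along a solution\<close>

text \<open>This is the tangent inequality at \<open>u / w\<close>, tested at \<open>u\<close> and
  multiplied by \<open>w\<close>. The left side is the perspective function of \<open>L\<close>. The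
  factor of \<open>w - 1\<close> is minus the energy, except that the gradient is still taken at the
  scaled control.\<close>

lemma perspective_le:
  fixes L :: "'a \<Rightarrow> 'b::real_inner \<Rightarrow> real"
  assumes conv: "\<And>x u v. L x u + Lu x u \<bullet> (v - u) \<le> L x v" and w: "w > 0"
  shows "w * L x (u /\<^sub>R w) \<le> L x u + (w - 1) * (L x u - Lu x (u /\<^sub>R w) \<bullet> u)"
proof -
  define e where "e = Lu x (u /\<^sub>R w)"
  have "w * (L x (u /\<^sub>R w) + e \<bullet> (u - u /\<^sub>R w)) \<le> w * L x u"
    using conv[of x "u /\<^sub>R w" u] w by (simp add: e_def mult_left_mono)
  moreover have "w * (e \<bullet> (u - u /\<^sub>R w)) = (w - 1) * (e \<bullet> u)"
    using w by (simp add: inner_diff_right inner_scaleR_right field_simps)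
  ultimately have "w * L x (u /\<^sub>R w) + (w - 1) * (e \<bullet> u) \<le> w * L x u"
    by (simp add: distrib_left)
  then show ?thesis by (simp add: e_def[symmetric] algebra_simps)
qed

text \<open>Uniform continuity on a compact set lets the gradient at \<open>u / w\<close> in
  \<open>perspective_le\<close> be replaced by the gradient at \<open>u\<close>, with an error
  uniform over bounded controls.\<close>

lemma energy_perturbation:
  fixes Lu :: "'a::metric_space \<Rightarrow> 'b::euclidean_space \<Rightarrow> 'b"
  assumes Lu: "continuous_on UNIV (\<lambda>(x,u). Lu x u)" and Om: "compact \<Omega>" and "\<epsilon> > 0"
  obtains d where "d > 0" "\<And>x u w. \<lbrakk>x \<in> \<Omega>; norm u \<le> K; 1/2 \<le> w; \<bar>w - 1\<bar> < d\<rbrakk> \<Longrightarrow>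
      \<bar>Lu x (u /\<^sub>R w) \<bullet> u - Lu x u \<bullet> u\<bar> < \<epsilon>"
proof -
  \<comment> \<open>The last coordinate stands for \<open>1 / w\<close>, which is at most 2 when
    \<open>w\<close> is at least \<open>1/2\<close>.\<close>
  define S where "S = \<Omega> \<times> cball (0::'b) K \<times> {0..2::real}"
  define \<Phi> where "\<Phi> = (\<lambda>(x,u,q). Lu x (q *\<^sub>R u) \<bullet> (u::'b))"
  have "continuous_on S (\<lambda>z. (fst z, snd (snd z) *\<^sub>R fst (snd z)))"
    by (intro continuous_intros)
  then have "continuous_on S (\<lambda>z. (\<lambda>(x,u). Lu x u) (fst z, snd (snd z) *\<^sub>R fst (snd z)))"
    by (rule continuous_on_compose2[OF Lu]) auto
  then have "continuous_on S \<Phi>"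
    unfolding \<Phi>_def case_prod_unfold by (intro continuous_intros) simp
  moreover have "compact S"
    unfolding S_def by (intro compact_Times Om compact_cball compact_Icc)
  ultimately have "uniformly_continuous_on S \<Phi>"
    by (rule compact_uniformly_continuous)
  then obtain d where d: "d > 0" "\<And>z z'. \<lbrakk>z \<in> S; z' \<in> S; dist z' z < d\<rbrakk> \<Longrightarrow> dist (\<Phi> z') (\<Phi> z) < \<epsilon>"
    using \<open>\<epsilon> > 0\<close> unfolding uniformly_continuous_on_def by metis
  show thesis
  proof
    \<comment> \<open>Halving \<open>d\<close> offsets the factor 2 by which
      \<open>\<bar>1 / w - 1\<bar>\<close> may exceed \<open>\<bar>w - 1\<bar>\<close>.\<close>
    show "d / 2 > 0" using d by simp
    fix x :: 'a and u :: 'b and w :: real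
    assume x: "x \<in> \<Omega>" "norm u \<le> K" and w: "1/2 \<le> w" "\<bar>w - 1\<bar> < d / 2"
    have "\<bar>inverse w - 1\<bar> = \<bar>w - 1\<bar> / w"
      using w(1) by (simp add: divide_simps abs_if split: if_splits)
    also have "\<dots> \<le> \<bar>w - 1\<bar> / (1/2)"
      using w(1) by (intro divide_left_mono) auto
    finally have "\<bar>inverse w - 1\<bar> < d" using w(2) by simp
    then have "dist (x, u, inverse w) (x, u, 1) < d"
      by (simp add: dist_Pair_Pair dist_real_def)
    moreover have "inverse w \<in> {0..2}" using w(1) by (auto simp: field_simps)
    ultimately have "dist (\<Phi> (x, u, inverse w)) (\<Phi> (x, u, 1)) < \<epsilon>"
      using d(2)[of "(x, u, 1)" "(x, u, inverse w)"] x by (auto simp: S_def)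
    then show "\<bar>Lu x (u /\<^sub>R w) \<bullet> u - Lu x u \<bullet> u\<bar> < \<epsilon>"
      by (simp add: \<Phi>_def dist_real_def)
  qed
qed

text \<open>If \<open>q < p\<close>, a reparametrisation of time which slows down on \<open>A\<close> and speeds up on \<open>B\<close> is a
  competitor of strictly smaller cost. The bound on the control is needed on \<open>A \<union> B\<close> only, where
  the time scale differs from one.\<close>
lemma energy_comparison:
  fixes L :: "real^'n \<Rightarrow> real^'m \<Rightarrow> real" and u :: "real \<Rightarrow> real^'m"
  assumes L: "continuous_on UNIV (\<lambda>(x,u). L x u)"
    and Lu: "continuous_on UNIV (\<lambda>(x,u). Lu x u)"
    and conv: "\<And>x u v. L x u + Lu x u \<bullet> (v - u) \<le> L x v"
    and nonneg: "\<And>x u. 0 \<le> L x u"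
    and sol: "is_solution L g u x" and ub[measurable]: "u \<in> borel_measurable borel"
    and fin: "cost L u x < \<infinity>"
    and Om: "compact \<Omega>" "\<And>t. t \<in> {0..1} \<Longrightarrow> x t \<in> \<Omega>"
    and A[measurable]: "A \<in> sets borel" and A01: "A \<subseteq> {0..1}" and Apos: "A \<notin> null_sets lborel"
    and B[measurable]: "B \<in> sets borel" and B01: "B \<subseteq> {0..1}" and Bpos: "B \<notin> null_sets lborel"
    and K: "\<And>t. t \<in> A \<union> B \<Longrightarrow> norm (u t) \<le> K"
    and p: "\<And>t. t \<in> A \<Longrightarrow> p \<le> Lu (x t) (u t) \<bullet> u t - L (x t) (u t)"
    and q: "\<And>t. t \<in> B \<Longrightarrow> Lu (x t) (u t) \<bullet> u t - L (x t) (u t) \<le> q"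
  shows "p \<le> q"
proof (rule ccontr)
  assume "\<not> p \<le> q"
  \<comment> \<open>A quarter of the gap: one error \<open>\<epsilon>\<close> on \<open>A\<close>
    and one on \<open>B\<close> consume half of \<open>p - q\<close>, so a gain proportional to
    \<open>2 * \<epsilon>\<close> survives.\<close>
  define \<epsilon> where "\<epsilon> = (p - q) / 4"
  have eps: "\<epsilon> > 0" using \<open>\<not> p \<le> q\<close> by (simp add: \<epsilon>_def)
  have disj: "t \<notin> B" if "t \<in> A" for t
    using p[of t] q[of t] \<open>\<not> p \<le> q\<close> that by linarith
  then have disj': "t \<notin> A" if "t \<in> B" for t using that by blast
  define a where "a = measure lborel A"
  define b where "b = measure lborel B"
  have finAB: "emeasure lborel A < \<infinity>" "emeasure lborel B < \<infinity>"
    using emeasure_mono[OF A01, of lborel] emeasure_mono[OF B01, of lborel]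
    by (auto simp: le_less_trans)
  have em: "emeasure lborel A = ennreal a" "emeasure lborel B = ennreal b"
    unfolding a_def b_def using finAB by (auto intro!: emeasure_eq_ennreal_measure)
  have "a \<noteq> 0" "b \<noteq> 0" using em Apos Bpos by (auto simp: null_sets_def)
  then have ab: "a > 0" "b > 0" by (auto simp: a_def b_def less_le)
  obtain d where d: "d > 0" "\<And>x u w. \<lbrakk>x \<in> \<Omega>; norm u \<le> K; 1/2 \<le> w; \<bar>w - 1\<bar> < d\<rbrakk> \<Longrightarrow>
      \<bar>Lu x (u /\<^sub>R w) \<bullet> u - Lu x u \<bullet> u\<bar> < \<epsilon>"
    using energy_perturbation[OF Lu Om(1) eps] by blast
  \<comment> \<open>The amount of time moved from \<open>B\<close> to \<open>A\<close>. The factor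
    \<open>min a b\<close> turns it into relative changes \<open>\<eta> / a\<close> and
    \<open>\<eta> / b\<close> of at most \<open>min 1 d / 2\<close>, hence at most
    \<open>1/2\<close> and below \<open>d\<close>.\<close>
  define \<eta> where "\<eta> = min a b * min 1 d / 2"
  have eta: "\<eta> > 0" using ab d(1) by (simp add: \<eta>_def)
  have eta_le: "\<eta> / c \<le> 1/2" "\<eta> / c < d" "\<eta> / c > 0" if "c = a \<or> c = b" for c
  proof -
    have c: "c > 0" "min a b \<le> c" using that ab by auto
    have "\<eta> \<le> min 1 d / 2 * c"
      unfolding \<eta>_def using mult_right_mono[OF c(2), of "min 1 d / 2"] d(1) by (simp add: mult.commute)
    then have le: "\<eta> / c \<le> min 1 d / 2" by (simp only: pos_divide_le_eq[OF c(1)])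
    then show "\<eta> / c \<le> 1/2" by linarith
    show "\<eta> / c < d" using le d(1) by linarith
    show "\<eta> / c > 0" using eta c by simp
  qed
  have eta_a: "\<eta> / a \<le> 1/2" "\<eta> / a < d" "\<eta> / a > 0" and eta_b: "\<eta> / b \<le> 1/2" "\<eta> / b < d" "\<eta> / b > 0"
    using eta_le[of a] eta_le[of b] by auto
  \<comment> \<open>The time gained on \<open>A\<close> equals the time lost on \<open>B\<close>, so
    the total duration stays 1.\<close>
  define w where "w t = 1 + \<eta> / a * indicator A t - \<eta> / b * indicator B t" for t :: real
  have wA: "w t = 1 + \<eta> / a" if "t \<in> A" for t using that disj[OF that] by (simp add: w_def)
  have wB: "w t = 1 - \<eta> / b" if "t \<in> B" for t using that disj'[OF that] by (simp add: w_def)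
  have w1: "w t = 1" if "t \<notin> A" "t \<notin> B" for t using that by (simp add: w_def)
  have w_bounds: "1/2 \<le> w t" "w t \<le> 2" for t
  proof -
    have "w t = 1 + \<eta> / a \<or> w t = 1 - \<eta> / b \<or> w t = 1" using wA wB w1 by blast
    with eta_a eta_b show "1/2 \<le> w t" "w t \<le> 2" by argo+
  qed
  have [measurable]: "w \<in> borel_measurable borel" unfolding w_def by measurable
  have hi: "(indicator S has_integral measure lborel S) {0..1::real}"
    if S: "S \<in> sets borel" "S \<subseteq> {0..1}" "emeasure lborel S < \<infinity>" for S
  proof -
    have "(indicat_real S has_integral measure lborel S) UNIV"
      using has_integral_integral_lborel[of "indicat_real S"] S by simp
    moreover have "indicat_real S = (\<lambda>t. if t \<in> {0..1} then indicator S t else 0)"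
      using S(2) by (auto simp: fun_eq_iff indicator_def)
    ultimately show ?thesis by (metis has_integral_restrict_UNIV)
  qed
  have "(w has_integral (1 + \<eta> / a * a - \<eta> / b * b)) {0..1}"
    unfolding w_def using hi[OF A A01 finAB(1)] hi[OF B B01 finAB(2)]
      has_integral_const_real[of "1::real" 0 1]
    by (intro has_integral_add has_integral_diff has_integral_mult_right) (simp_all add: a_def b_def)
  then have w_int: "(w has_integral 1) {0..1}" using ab by simp
  have adm: "admissible g u x" using sol by (simp add: is_solution_def)
  obtain v y where vy: "admissible g v y"
    "cost L v y = (\<integral>\<^sup>+ t. ennreal (w t * L (x t) (u t /\<^sub>R w t)) * indicator {0..1} t \<partial>lborel)"
    using time_change_admissible[OF L adm ub _ w_bounds _ w_int] by auto
  define z where "z t = x (max 0 (min 1 t))" for t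
  have z: "z t = x t" if "t \<in> {0..1}" for t using that by (simp add: z_def)
  have [measurable]: "z \<in> borel_measurable borel"
    unfolding z_def using adm by (intro borel_measurable_abs_cont_on_clamp) (auto simp: admissible_def)
  have [measurable]: "(\<lambda>t. L (z t) (u t)) \<in> borel_measurable borel"
    using borel_measurable_continuous_Pair[OF _ _ L[unfolded case_prod_unfold], of z borel u] by simp
  define F where "F t = L (z t) (u t) * indicator {0..1} t" for t
  \<comment> \<open>\<open>H\<close> will dominate the change of the integrand. It is constant on
    each of \<open>A\<close> and \<open>B\<close>, and the choice of \<open>\<epsilon>\<close> makes
    its integral \<open>- (2 * \<eta> * \<epsilon>)\<close>.\<close>
  define H where "H t = \<eta> / a * (\<epsilon> - p) * indicator A t + \<eta> / b * (\<epsilon> + q) * indicator B t" for t :: real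
  have F_nonneg: "0 \<le> F t" for t unfolding F_def using nonneg by simp
  have cost_F: "cost L u x = (\<integral>\<^sup>+ t. ennreal (F t) \<partial>lborel)"
    unfolding cost_eq_nn_integral_lborel F_def
    by (intro nn_integral_cong) (auto simp: z split: split_indicator)
  have Fi: "integrable lborel F"
  proof (rule integrableI_nonneg)
    show "F \<in> borel_measurable lborel" unfolding F_def by measurable
    show "(\<integral>\<^sup>+ t. ennreal (F t) \<partial>lborel) < \<infinity>" using fin cost_F by simp
  qed (simp add: F_nonneg)
  have Hi: "integrable lborel H"
    unfolding H_def using finAB by (intro Bochner_Integration.integrable_add integrable_mult_right) auto
  have "integral\<^sup>L lborel H = \<eta> / a * (\<epsilon> - p) * a + \<eta> / b * (\<epsilon> + q) * b"
    unfolding H_def using finAB by (subst Bochner_Integration.integral_add) (auto simp: a_def b_def)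
  also have "\<dots> = - (2 * \<eta> * \<epsilon>)"
    using ab by (simp add: \<epsilon>_def field_simps)
  finally have IH: "integral\<^sup>L lborel H = - (2 * \<eta> * \<epsilon>)" .
  have le: "w t * L (x t) (u t /\<^sub>R w t) * indicator {0..1} t \<le> F t + H t" for t
  proof (cases "t \<in> {0..1}")
    case False
    then have "t \<notin> A" "t \<notin> B" using A01 B01 by auto
    with False show ?thesis by (simp add: F_def H_def)
  next
    case True
    have wt: "w t > 0" using w_bounds(1)[of t] by linarith
    let ?E = "Lu (x t) (u t) \<bullet> u t" and ?E' = "Lu (x t) (u t /\<^sub>R w t) \<bullet> u t" and ?L = "L (x t) (u t)"
    have main: "w t * L (x t) (u t /\<^sub>R w t) \<le> ?L + (w t - 1) * (?L - ?E')"
      using conv by (rule perspective_le) (rule wt)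
    have "(w t - 1) * (?L - ?E') \<le> H t"
    proof -
      consider "t \<in> A" | "t \<in> B" | "t \<notin> A" "t \<notin> B" by blast
      then show ?thesis
      proof cases
        case 1
        have "\<bar>?E' - ?E\<bar> < \<epsilon>"
          using 1 True K[of t] Om(2)[of t] wA[of t] eta_a w_bounds(1)[of t] by (intro d(2)) auto
        then have "?L - ?E' \<le> \<epsilon> - p" using p[OF 1] by linarith
        then have "\<eta> / a * (?L - ?E') \<le> \<eta> / a * (\<epsilon> - p)"
          using eta_a(3) by (intro mult_left_mono) auto
        moreover have "H t = \<eta> / a * (\<epsilon> - p)" using 1 disj[OF 1] by (simp add: H_def)
        ultimately show ?thesis using wA[OF 1] by simp
      next
        case 2
        have "\<bar>?E' - ?E\<bar> < \<epsilon>"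
          using 2 True K[of t] Om(2)[of t] wB[of t] eta_b w_bounds(1)[of t] by (intro d(2)) auto
        then have "?E' - ?L \<le> \<epsilon> + q" using q[OF 2] by linarith
        then have "\<eta> / b * (?E' - ?L) \<le> \<eta> / b * (\<epsilon> + q)"
          using eta_b(3) by (intro mult_left_mono) auto
        moreover have "H t = \<eta> / b * (\<epsilon> + q)" using 2 disj'[OF 2] by (simp add: H_def)
        moreover have "(w t - 1) * (?L - ?E') = \<eta> / b * (?E' - ?L)"
        proof -
          have "w t - 1 = - (\<eta> / b)" using wB[OF 2] by simp
          then show ?thesis
            by (simp only: minus_mult_left[symmetric] mult_minus_right[symmetric] minus_diff_eq)
        qed
        ultimately show ?thesis by linarith
      next
        case 3
        then show ?thesis using w1 by (simp add: H_def)
      qed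
    qed
    with main True show ?thesis by (simp add: F_def z)
  qed
  \<comment> \<open>\<open>ennreal\<close> cuts negative reals off at 0. Nonnegativity of the
    majorant makes its integral convert faithfully and the final comparison of costs one of real
    numbers.\<close>
  have FH: "0 \<le> F t + H t" for t
  proof -
    have "0 \<le> w t * L (x t) (u t /\<^sub>R w t) * indicator {0..1} t"
      using nonneg w_bounds(1)[of t] by simp
    with le[of t] show ?thesis by linarith
  qed
  have "cost L v y \<le> (\<integral>\<^sup>+ t. ennreal (F t + H t) \<partial>lborel)"
    unfolding vy(2)
  proof (rule nn_integral_mono)
    fix t
    have "ennreal (w t * L (x t) (u t /\<^sub>R w t)) * indicator {0..1} t
        = ennreal (w t * L (x t) (u t /\<^sub>R w t) * indicator {0..1} t)"
      by (auto split: split_indicator)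
    also have "\<dots> \<le> ennreal (F t + H t)" by (rule ennreal_leI[OF le])
    finally show "ennreal (w t * L (x t) (u t /\<^sub>R w t)) * indicator {0..1} t \<le> ennreal (F t + H t)" .
  qed
  also have "\<dots> = ennreal (integral\<^sup>L lborel (\<lambda>t. F t + H t))"
    using Fi Hi FH by (intro nn_integral_eq_integral Bochner_Integration.integrable_add) auto
  also have "integral\<^sup>L lborel (\<lambda>t. F t + H t) = integral\<^sup>L lborel F - 2 * \<eta> * \<epsilon>"
    using Fi Hi IH by simp
  finally have "cost L v y \<le> ennreal (integral\<^sup>L lborel F - 2 * \<eta> * \<epsilon>)" .
  moreover have "cost L u x \<le> cost L v y"
    using sol vy(1) by (simp add: is_solution_def)
  moreover have "cost L u x = ennreal (integral\<^sup>L lborel F)"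
    unfolding cost_F using Fi F_nonneg by (intro nn_integral_eq_integral) auto
  ultimately have le': "ennreal (integral\<^sup>L lborel F) \<le> ennreal (integral\<^sup>L lborel F - 2 * \<eta> * \<epsilon>)"
    by simp
  have "0 \<le> integral\<^sup>L lborel (\<lambda>t. F t + H t)" using FH by (intro Bochner_Integration.integral_nonneg) auto
  then have "0 \<le> integral\<^sup>L lborel F - 2 * \<eta> * \<epsilon>" using Fi Hi IH by simp
  with le' have "integral\<^sup>L lborel F \<le> integral\<^sup>L lborel F - 2 * \<eta> * \<epsilon>"
    by (simp add: ennreal_le_iff)
  then show False using mult_pos_pos[OF eta eps] by linarith
qed

section \<open>The bound on the control\<close>

text \<open>Absolute continuity allows the differential equation to be integrated from 0 to
  \<open>t\<close>, and the operator norm of \<open>g\<close> bounds the integrand. This is where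
  the radius of the ball \<open>\<Omega>\<close> comes from.\<close>

lemma admissible_norm_le:
  fixes u :: "real \<Rightarrow> real^'m" and x :: "real \<Rightarrow> real^'n"
  assumes adm: "admissible g u x" and g: "\<And>x. onorm (\<lambda>u. g x *v u) \<le> c"
    and t: "t \<in> {0..1}"
  shows "norm (x t) \<le> c * integral\<^sup>L (lebesgue_on {0..1}) (\<lambda>t. norm (u t))"
proof -
  have gu: "norm (g y *v z) \<le> c * norm z" for y z
  proof -
    have "norm (g y *v z) \<le> onorm (\<lambda>u. g y *v u) * norm z"
      by (rule onorm) (rule matrix_vector_mul_bounded_linear)
    also have "\<dots> \<le> c * norm z" using g by (intro mult_right_mono) auto
    finally show ?thesis .
  qed
  have c: "0 \<le> c"
    using onorm_pos_le[OF matrix_vector_mul_bounded_linear, of "g 0"] g[of 0] by linarith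
  have iu: "integrable (lebesgue_on {0..1}) u" and ac: "abs_cont_on 0 1 x" and x0: "x 0 = 0"
    and dx: "AE t in lebesgue. t \<in> {0..1} \<longrightarrow>
        (x has_vector_derivative (g (x t) *v u t)) (at t within {0..1})"
    using adm by (auto simp: admissible_def)
  obtain N where N: "N \<in> null_sets lebesgue" "{t \<in> space lebesgue. \<not> (t \<in> {0..1} \<longrightarrow>
        (x has_vector_derivative (g (x t) *v u t)) (at t within {0..1}))} \<subseteq> N"
    using dx unfolding eventually_ae_filter by blast
  have "((\<lambda>t. g (x t) *v u t) has_integral (x t - x 0)) {0..t}"
  proof (rule has_integral_vector_derivative_abs_cont)
    show "abs_cont_on 0 t x" using abs_cont_on_subset[OF ac] t by auto
    show "0 \<le> t" using t by simp
    show "negligible N" using N by (simp add: negligible_iff_null_sets)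
    fix s assume s: "s \<in> {0..t} - N"
    then have "(x has_vector_derivative (g (x s) *v u s)) (at s within {0..1})"
      using N(2) t by auto
    then show "(x has_vector_derivative (g (x s) *v u s)) (at s within {0..t})"
      by (rule has_vector_derivative_within_subset) (use t in auto)
  qed
  then have xt: "(\<lambda>t. g (x t) *v u t) integrable_on {0..t}"
      "x t = integral {0..t} (\<lambda>t. g (x t) *v u t)"
    using x0 by (auto simp: has_integral_iff)
  have nu: "integrable (lebesgue_on {0..1}) (\<lambda>t. c * norm (u t))"
    using iu by (intro integrable_mult_right integrable_norm)
  have nu': "(\<lambda>t. c * norm (u t)) integrable_on {0..1}"
    by (rule integrable_on_lebesgue_on[OF nu]) simp
  have nut: "(\<lambda>t. c * norm (u t)) integrable_on {0..t}"
    by (rule integrable_on_subinterval[OF nu']) (use t in auto)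
  have "norm (x t) \<le> integral {0..t} (\<lambda>t. c * norm (u t))"
    unfolding xt(2) by (rule Henstock_Kurzweil_Integration.integral_norm_bound_integral[OF xt(1) nut gu])
  also have "\<dots> \<le> integral {0..1} (\<lambda>t. c * norm (u t))"
    by (rule integral_subset_le[OF _ nut nu']) (use t c in auto)
  also have "\<dots> = integral\<^sup>L (lebesgue_on {0..1}) (\<lambda>t. c * norm (u t))"
    by (rule lebesgue_integral_eq_integral[OF nu, symmetric]) simp
  finally show ?thesis by simp
qed

lemma cost_zero:
  "cost L (\<lambda>t. 0) (\<lambda>t. 0) = ennreal (L 0 0)"
  by (simp add: cost_eq_nn_integral_lborel nn_integral_cmult)

lemma admissible_zero: "admissible g (\<lambda>t. 0) (\<lambda>t. 0)"
  unfolding admissible_def abs_cont_on_def by (auto intro!: exI[of _ 1])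

theorem theorem1:
  fixes L :: "real^'n \<Rightarrow> real^'m \<Rightarrow> real"
    and Lx :: "real^'n \<Rightarrow> real^'m \<Rightarrow> real^'n"
    and Lu :: "real^'n \<Rightarrow> real^'m \<Rightarrow> real^'m"
    and g :: "real^'n \<Rightarrow> real^'m^'n"
    and Dg :: "real^'n \<Rightarrow> real^'n \<Rightarrow> real^'m^'n"
    and \<theta> :: "real \<Rightarrow> real"
    and \<mu> \<xi> \<delta> c\<^sub>g c\<^sub>D r\<^sub>0 T\<^sub>0 :: real
    and uh :: "real \<Rightarrow> real^'m" and xh :: "real \<Rightarrow> real^'n"
  assumes L_deriv: "\<And>x u. ((\<lambda>(y,v). L y v) has_derivative
                         (\<lambda>(h,k). Lx x u \<bullet> h + Lu x u \<bullet> k)) (at (x,u))"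
    and Lx_cont: "continuous_on UNIV (\<lambda>(x,u). Lx x u)"
    and Lu_cont: "continuous_on UNIV (\<lambda>(x,u). Lu x u)"
    and g_deriv: "\<And>x. (g has_derivative Dg x) (at x)"
    and Dg_cont: "\<And>h. continuous_on UNIV (\<lambda>x. Dg x h)"
    \<comment> \<open>(C1)\<close>
    and C1: "\<And>x u. L x u \<ge> \<theta> (norm u) \<and> \<theta> (norm u) > 0"
    and C1_lim: "((\<lambda>r. r / \<theta> r) \<longlongrightarrow> 0) at_top"
    \<comment> \<open>(C2)\<close>
    and mu_pos: "\<mu> > 0"
    and C2: "\<And>x u v. L x u + Lu x u \<bullet> (v - u) + \<mu> / 2 * (norm (v - u))\<^sup>2 \<le> L x v"
    \<comment> \<open>(C3); the gradient in (t,x) reduces to the x-gradient since L does not depend on t\<close>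
    and xi_pos: "\<xi> > 0" and delta_pos: "\<delta> > 0"
    and C3: "\<And>x u. norm (Lx x u) * norm (g x *v u) \<le> \<xi> * L x u + \<delta>"
    \<comment> \<open>(C4), with operator norms\<close>
    and cg_pos: "c\<^sub>g > 0" and cD_pos: "c\<^sub>D > 0"
    and C4_g: "\<And>x. onorm (\<lambda>u. g x *v u) \<le> c\<^sub>g"
    and C4_Dg: "\<And>x h. onorm (\<lambda>u. Dg x h *v u) \<le> c\<^sub>D * norm h"
    \<comment> \<open>choice of r0 and T0\<close>
    and r0_pos: "r\<^sub>0 > 0"
    and r0: "\<And>r. r \<ge> r\<^sub>0 \<Longrightarrow> \<theta> r \<ge> r"
    and T0: "0 < T\<^sub>0" "T\<^sub>0 < 1"
    and beta: "let c = r\<^sub>0 + integral {0..1} (\<lambda>t::real. L 0 0);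
                   \<Omega> = cball (0::real^'n) (c\<^sub>g * c);
                   \<sigma> = (\<lambda>r. Sup {Lu x u \<bullet> u - L x u | x u. x \<in> \<Omega> \<and> norm u \<le> r})
               in \<sigma> ((c + 1) / T\<^sub>0) > \<delta> / \<xi>"
    and sol: "is_solution L g uh xh"
  shows "let c = r\<^sub>0 + integral {0..1} (\<lambda>t::real. L 0 0);
             \<Omega> = cball (0::real^'n) (c\<^sub>g * c);
             \<Lambda>\<^sub>0 = Sup ((\<lambda>x. L x 0) ` \<Omega>);
             \<Lambda>\<^sub>1 = Sup ((\<lambda>x. norm (Lu x 0)) ` \<Omega>);
             \<sigma> = (\<lambda>r. Sup {Lu x u \<bullet> u - L x u | x u. x \<in> \<Omega> \<and> norm u \<le> r});
             \<beta> = \<sigma> ((c + 1) / T\<^sub>0);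
             ell = max (sqrt (2 / \<mu> * (\<Lambda>\<^sub>0 + \<beta>)))
                     ((\<Lambda>\<^sub>1 + sqrt (\<Lambda>\<^sub>1\<^sup>2 + 4 * \<mu> * \<Lambda>\<^sub>0)) / 2)
         in AE t in lebesgue. t \<in> {0..1} \<longrightarrow> norm (uh t) \<le> ell"
proof -

  \<comment> \<open>Constants and extremal values over the compact set\<close>
  define c where "c = r\<^sub>0 + L 0 0"
  define \<Omega> where "\<Omega> = cball (0::real^'n) (c\<^sub>g * c)"
  define \<Lambda>\<^sub>0 where "\<Lambda>\<^sub>0 = Sup ((\<lambda>x. L x 0) ` \<Omega>)"
  \<comment> \<open>The radius at which \<open>\<sigma>\<close> is evaluated. It exceeds
    \<open>c\<close>, which will bound the integral of the norm of the control, so the norm cannot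
    stay above \<open>R\<close> almost everywhere.\<close>
  define R where "R = (c + 1) / T\<^sub>0"
  define E where "E x u = Lu x u \<bullet> u - L x u" for x u
  define \<beta> where "\<beta> = Sup {E x u | x u. x \<in> \<Omega> \<and> norm u \<le> R}"
  have Lpos: "0 < L x u" for x u using C1[where x=x and u=u] by linarith
  have cpos: "0 < c" using r0_pos Lpos[of 0 0] by (simp add: c_def)
  have cR: "c < R"
  proof -
    have "c * T\<^sub>0 \<le> c * 1" using T0 cpos by (intro mult_left_mono) auto
    then have "c * T\<^sub>0 < c + 1" by linarith
    then show ?thesis using T0 by (simp add: R_def field_simps)
  qed
  have Lc: "continuous_on UNIV (\<lambda>(x,u). L x u)"
    using has_derivative_continuous[OF L_deriv]
    by (auto intro!: continuous_at_imp_continuous_on)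
  have Ec: "continuous_on UNIV (\<lambda>z. E (fst z) (snd z))"
    unfolding E_def using Lc Lu_cont by (auto intro!: continuous_intros simp: case_prod_unfold)
  have conv: "L x u + Lu x u \<bullet> (v - u) \<le> L x v" for x u v
  proof -
    have "0 \<le> \<mu> / 2 * (norm (v - u))\<^sup>2" using mu_pos by simp
    with C2[of x u v] show ?thesis by linarith
  qed
  have Om: "compact \<Omega>" by (simp add: \<Omega>_def)
  have Lam: "L x 0 \<le> \<Lambda>\<^sub>0" if "x \<in> \<Omega>" for x
    unfolding \<Lambda>\<^sub>0_def
  proof (rule cSup_upper)
    have "continuous_on \<Omega> (\<lambda>x. (\<lambda>(x,u). L x u) (x, 0))"
      by (rule continuous_on_compose2[OF Lc]) (auto intro!: continuous_intros)
    then have "compact ((\<lambda>x. L x 0) ` \<Omega>)"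
      using Om by (intro compact_continuous_image) simp_all
    then show "bdd_above ((\<lambda>x. L x 0) ` \<Omega>)"
      by (intro bounded_imp_bdd_above compact_imp_bounded)
  qed (use that in auto)
  have beta_ge: "E x u \<le> \<beta>" if "x \<in> \<Omega>" "norm u \<le> R" for x u
    unfolding \<beta>_def
  proof (rule cSup_upper)
    have "compact ((\<lambda>z. E (fst z) (snd z)) ` (\<Omega> \<times> cball 0 R))"
      by (intro compact_continuous_image continuous_on_subset[OF Ec] compact_Times Om) auto
    moreover have "{E x u | x u. x \<in> \<Omega> \<and> norm u \<le> R} = (\<lambda>z. E (fst z) (snd z)) ` (\<Omega> \<times> cball 0 R)"
      by (force simp: image_iff)
    ultimately show "bdd_above {E x u | x u. x \<in> \<Omega> \<and> norm u \<le> R}"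
      by (simp add: bounded_imp_bdd_above compact_imp_bounded)
  qed (use that in auto)

  \<comment> \<open>A priori bounds by comparison with the zero control\<close>
  have adm0: "admissible g uh xh" using sol by (simp add: is_solution_def)
  have "uh \<in> borel_measurable (lebesgue_on {0..1})"
    using adm0 by (auto simp: admissible_def)
  then obtain u where ub[measurable]: "u \<in> borel_measurable borel"
    and ueq: "AE t in lebesgue. t \<in> {0..1} \<longrightarrow> u t = uh t"
    by (rule lebesgue_on_ex_borel_measurable) auto
  have sol': "is_solution L g u xh"
    by (rule is_solution_cong_AE[OF sol ub ueq])
  then have adm: "admissible g u xh" by (simp add: is_solution_def)
  have "cost L u xh \<le> cost L (\<lambda>t. 0) (\<lambda>t. 0)"
    using sol' admissible_zero by (auto simp: is_solution_def)
  then have cost_le: "cost L u xh \<le> ennreal (L 0 0)" by (simp only: cost_zero)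
  have xm: "xh \<in> borel_measurable (lebesgue_on {0..1})"
    using adm by (intro continuous_imp_measurable_on_sets_lebesgue abs_cont_on_imp_continuous_on)
      (auto simp: admissible_def)
  have Lm: "(\<lambda>t. L (xh t) (u t)) \<in> borel_measurable (lebesgue_on {0..1})"
  proof -
    have "u \<in> borel_measurable (lebesgue_on {0..1})"
      by (intro measurable_restrict_space1 measurable_completion) simp
    then show ?thesis
      using borel_measurable_continuous_Pair[OF xm _ Lc[unfolded case_prod_unfold], of u] by simp
  qed
  \<comment> \<open>Where the norm is at least \<open>r\<^sub>0\<close>, the growth function
    \<open>\<theta>\<close> dominates it by the choice of \<open>r\<^sub>0\<close>; elsewhere
    \<open>r\<^sub>0\<close> alone suffices, since \<open>L\<close> is positive.\<close>
  have u_le: "norm u \<le> r\<^sub>0 + L x u" for u x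
    using C1[where x=x and u=u] r0[of "norm u"] r0_pos by (cases "norm u \<ge> r\<^sub>0") auto
  have "(\<integral>\<^sup>+ t. ennreal (norm (u t)) \<partial>lebesgue_on {0..1})
      \<le> (\<integral>\<^sup>+ t. ennreal r\<^sub>0 + ennreal (L (xh t) (u t)) \<partial>lebesgue_on {0..1})"
    using u_le r0_pos Lpos[THEN less_imp_le]
    by (intro nn_integral_mono) (simp add: ennreal_plus[symmetric] del: ennreal_plus)
  also have "\<dots> = ennreal r\<^sub>0 + cost L u xh"
    using Lm by (subst nn_integral_add) (auto simp: cost_def emeasure_restrict_space)
  also have "\<dots> \<le> ennreal r\<^sub>0 + ennreal (L 0 0)"
    using cost_le by (rule add_left_mono)
  also have "\<dots> = ennreal c"
    using r0_pos Lpos[of 0 0] by (simp add: c_def)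
  finally have nu: "(\<integral>\<^sup>+ t. ennreal (norm (u t)) \<partial>lebesgue_on {0..1}) \<le> ennreal c" .
  have "integrable (lebesgue_on {0..1}) u" using adm by (simp add: admissible_def)
  then have "ennreal (integral\<^sup>L (lebesgue_on {0..1}) (\<lambda>t. norm (u t)))
      = (\<integral>\<^sup>+ t. ennreal (norm (u t)) \<partial>lebesgue_on {0..1})"
    by (intro nn_integral_eq_integral[symmetric] integrable_norm) auto
  with nu have "ennreal (integral\<^sup>L (lebesgue_on {0..1}) (\<lambda>t. norm (u t))) \<le> ennreal c"
    by (simp only:)
  then have int_u: "integral\<^sup>L (lebesgue_on {0..1}) (\<lambda>t. norm (u t)) \<le> c"
    using cpos by (simp add: ennreal_le_iff)
  have xOm: "xh t \<in> \<Omega>" if "t \<in> {0..1}" for t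
  proof -
    have "norm (xh t) \<le> c\<^sub>g * c"
      using admissible_norm_le[OF adm C4_g that] mult_left_mono[OF int_u less_imp_le[OF cg_pos]]
      by (rule order_trans)
    then show ?thesis by (simp add: \<Omega>_def)
  qed

  \<comment> \<open>The energy along the solution\<close>
  define z where "z t = xh (max 0 (min 1 t))" for t
  have z: "z t = xh t" if "t \<in> {0..1}" for t using that by (simp add: z_def)
  have [measurable]: "z \<in> borel_measurable borel"
    unfolding z_def using adm by (intro borel_measurable_abs_cont_on_clamp) (auto simp: admissible_def)
  have [measurable]: "(\<lambda>t. E (z t) (u t)) \<in> borel_measurable borel"
    using borel_measurable_continuous_Pair[OF _ _ Ec, of z borel u] by simp
  define B where "B = {t \<in> {0..1}. norm (u t) \<le> R}"
  have Bm: "B \<in> sets borel" unfolding B_def by measurable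
  \<comment> \<open>Chebyshev's argument: a norm above \<open>R\<close> almost everywhere would have
    integral at least \<open>R\<close>, while the integral is at most \<open>c\<close>.\<close>
  have Bpos: "B \<notin> null_sets lborel"
  proof
    assume "B \<in> null_sets lborel"
    then have "AE t in lborel. t \<notin> B" by (rule AE_not_in)
    then have "AE t in lborel. ennreal R * indicator {0..1} t \<le> ennreal (norm (u t)) * indicator {0..1} t"
      by eventually_elim (auto simp: B_def split: split_indicator)
    then have "(\<integral>\<^sup>+ t. ennreal R * indicator {0..1::real} t \<partial>lborel)
        \<le> (\<integral>\<^sup>+ t. ennreal (norm (u t)) * indicator {0..1} t \<partial>lborel)"
      by (rule nn_integral_mono_AE)
    also have "\<dots> \<le> ennreal c" using nu by (simp add: nn_integral_lebesgue_on)
    finally have "ennreal R \<le> ennreal c" by (simp add: nn_integral_cmult)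
    then show False using cR cpos by (simp add: ennreal_le_iff)
  qed
  \<comment> \<open>One index both bounds the control, as \<open>energy_comparison\<close> requires,
    and keeps the energy at a fixed distance above \<open>\<beta>\<close>. Together these sets
    exhaust the times in the unit interval with energy above \<open>\<beta>\<close>.\<close>
  define A where "A k = {t \<in> {0..1}. norm (u t) \<le> real k \<and> \<beta> + 1 / Suc k \<le> E (z t) (u t)}" for k
  have Am: "A k \<in> sets borel" for k unfolding A_def by measurable
  have A_null: "A k \<in> null_sets lborel" for k
  proof (rule ccontr)
    assume Apos: "A k \<notin> null_sets lborel"
    have "\<beta> + 1 / Suc k \<le> \<beta>"
    proof (rule energy_comparison[OF Lc Lu_cont conv _ sol' ub _ Om xOm Am _ Apos Bm _ Bpos])
      show "0 \<le> L x u" for x u using Lpos[of x u] by simp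
      show "cost L u xh < \<infinity>" using cost_le by (rule le_less_trans) simp
      show "A k \<subseteq> {0..1}" "B \<subseteq> {0..1}" by (auto simp: A_def B_def)
      show "norm (u t) \<le> max (real k) R" if "t \<in> A k \<union> B" for t
        using that by (auto simp: A_def B_def)
      show "\<beta> + 1 / Suc k \<le> Lu (xh t) (u t) \<bullet> u t - L (xh t) (u t)" if "t \<in> A k" for t
        using that z by (auto simp: A_def E_def)
      show "Lu (xh t) (u t) \<bullet> u t - L (xh t) (u t) \<le> \<beta>" if "t \<in> B" for t
        using that beta_ge[of "xh t" "u t"] xOm by (auto simp: B_def E_def)
    qed
    then show False by simp
  qed
  have "AE t in lborel. \<forall>k. t \<notin> A k"
    unfolding AE_all_countable using A_null by (auto intro: AE_not_in)
  then have "AE t in lebesgue. \<forall>k. t \<notin> A k" by (rule AE_completion)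

  \<comment> \<open>From the energy to the control\<close>
  with ueq have bound: "AE t in lebesgue. t \<in> {0..1} \<longrightarrow> norm (uh t) \<le> sqrt (2 / \<mu> * (\<Lambda>\<^sub>0 + \<beta>))"
  proof eventually_elim
    case (elim t)
    show ?case
    proof
      assume t: "t \<in> {0..1}"
      have "E (xh t) (u t) \<le> \<beta>"
      proof (rule ccontr)
        assume "\<not> E (xh t) (u t) \<le> \<beta>"
        then obtain k1 where k1: "1 / Suc k1 < E (xh t) (u t) - \<beta>"
          using nat_approx_posE[of "E (xh t) (u t) - \<beta>"] by auto
        obtain k2 :: nat where k2: "norm (u t) \<le> real k2" using real_arch_simple by blast
        \<comment> \<open>Both conditions that define \<open>A\<close> weaken as the index grows, so
          the larger of the two indices satisfies them together.\<close>
        have "1 / real (Suc (max k1 k2)) \<le> 1 / real (Suc k1)" by (simp add: frac_le)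
        then have "t \<in> A (max k1 k2)"
          using t k1 k2 z[OF t] by (auto simp: A_def)
        with elim show False by blast
      qed
      \<comment> \<open>Strong convexity based at \<open>u t\<close> and tested at the zero control:
        the first two terms combine to minus the energy, which leaves the quadratic term bounded by
        \<open>\<Lambda>\<^sub>0 + \<beta>\<close>.\<close>
      moreover have "L (xh t) (u t) + Lu (xh t) (u t) \<bullet> (0 - u t) + \<mu> / 2 * (norm (0 - u t))\<^sup>2 \<le> L (xh t) 0"
        by (rule C2)
      moreover have "L (xh t) 0 \<le> \<Lambda>\<^sub>0" using Lam xOm t by blast
      ultimately have "\<mu> / 2 * (norm (u t))\<^sup>2 \<le> \<Lambda>\<^sub>0 + \<beta>"
        by (simp add: E_def)
      then have "(norm (u t))\<^sup>2 \<le> 2 / \<mu> * (\<Lambda>\<^sub>0 + \<beta>)"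
        using mu_pos by (simp add: field_simps)
      then have "norm (u t) \<le> sqrt (2 / \<mu> * (\<Lambda>\<^sub>0 + \<beta>))" by (rule real_le_rsqrt)
      then show "norm (uh t) \<le> sqrt (2 / \<mu> * (\<Lambda>\<^sub>0 + \<beta>))" using elim t by simp
    qed
  qed
  have c_eq: "r\<^sub>0 + integral {0..1} (\<lambda>t::real. L 0 0) = c" by (simp add: c_def)
  show ?thesis
    unfolding Let_def c_eq
    unfolding \<Omega>_def[symmetric] R_def[symmetric]
    unfolding \<Lambda>\<^sub>0_def[symmetric] E_def[symmetric]
    unfolding \<beta>_def[symmetric]
    \<comment> \<open>The square root is the first entry of the maximum in the goal.\<close>
    using bound by eventually_elim auto
qed

end
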